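(* The instances $(G,w,k_1,k_2,k_3)$ of M-EPVCB in which $k_3\le k_1$ can be solved in FPT($k_1$) time, i.e., in time $g(k_1)\cdot\mathrm{poly}(\text{input size})$ for some computable function $g$.
   Context: Graphs are finite, simple, undirected. For $V_0\subseteq V(G)$, $E(V_0)$ denotes the set of edges with at least one endpoint in $V_0$. M-EPVCB: given a bipartite graph $G=(V,E)$, an edge-weight function $w:E\to\mathbb{N}$ (positive integers), and positive integers $k_1,k_2,k_3$, decide whether there exists $V_0\subseteq V$ with $|V_0|\le k_1$ such that $\sum_{e\in E(V_0)}w(e)\ge k_2$ and $E(V_0)$ contains a matching $M$ with $\sum_{e\in M}w(e)\ge k_3$. *)

theory Defs
  imports
    "HOL-Library.Log_Nat"
    "HOL-Computational_Algebra.Polynomial"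
begin

section \<open>Machine model\<close>

text \<open>
  The model is a first-order call-by-value functional language over binary trees with
  natural-number leaves (pure first-order Lisp).  A program is a finite list of function bodies; functions take one argument, variables are
  de Bruijn indices.  Every evaluation step costs 1, and arithmetic is charged logarithmically, by
  the bit lengths of its operands.  Sharing subtrees costs nothing, as with pointers, and there is
  no unit-cost comparison of trees, so that a run of time t can be simulated by a Turing machine in
  time polynomial in t and the input size, and conversely (cf. N. D. Jones, Computability and
  Complexity: From a Programming Perspective).
\<close>

datatype val = Num nat | Node val val

datatype expr =
    EVar nat
  | EConst nat
  | EAdd expr expr
  | ESub expr expr
  | ENode expr expr
  | EFst expr
  | ESnd expr
  | EIf expr expr expr
  | ELet expr expr
  | ECall nat expr

type_synonym program = "expr list"

text \<open>
  \<open>eval p \<rho> e v t\<close>: in program \<open>p\<close> and environment \<open>\<rho>\<close>, the expression \<open>e\<close> terminates with value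
  \<open>v\<close> after time \<open>t\<close>.  \<open>ESub\<close> is truncated subtraction, which also provides comparison; \<open>EIf\<close> takes
  its second branch exactly on \<open>Num 0\<close>, the value that also represents the empty list.
\<close>

inductive eval :: "program \<Rightarrow> val list \<Rightarrow> expr \<Rightarrow> val \<Rightarrow> nat \<Rightarrow> bool" for p :: program where
  Var: "i < length \<rho> \<Longrightarrow> eval p \<rho> (EVar i) (\<rho> ! i) 1"
| Const: "eval p \<rho> (EConst n) (Num n) 1"
| Add: "eval p \<rho> a (Num m) s \<Longrightarrow> eval p \<rho> b (Num n) t \<Longrightarrow>
    eval p \<rho> (EAdd a b) (Num (m + n)) (s + t + floorlog 2 m + floorlog 2 n + 1)"
| Sub: "eval p \<rho> a (Num m) s \<Longrightarrow> eval p \<rho> b (Num n) t \<Longrightarrow>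
    eval p \<rho> (ESub a b) (Num (m - n)) (s + t + floorlog 2 m + floorlog 2 n + 1)"
| Node: "eval p \<rho> a u s \<Longrightarrow> eval p \<rho> b v t \<Longrightarrow> eval p \<rho> (ENode a b) (Node u v) (s + t + 1)"
| Fst: "eval p \<rho> a (Node u v) t \<Longrightarrow> eval p \<rho> (EFst a) u (t + 1)"
| Snd: "eval p \<rho> a (Node u v) t \<Longrightarrow> eval p \<rho> (ESnd a) v (t + 1)"
| If_nonzero: "eval p \<rho> c u s \<Longrightarrow> u \<noteq> Num 0 \<Longrightarrow> eval p \<rho> a v t \<Longrightarrow>
    eval p \<rho> (EIf c a b) v (s + t + 1)"
| If_zero: "eval p \<rho> c (Num 0) s \<Longrightarrow> eval p \<rho> b v t \<Longrightarrow> eval p \<rho> (EIf c a b) v (s + t + 1)"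
| Let: "eval p \<rho> a u s \<Longrightarrow> eval p (u # \<rho>) b v t \<Longrightarrow> eval p \<rho> (ELet a b) v (s + t + 1)"
| Call: "eval p \<rho> a u s \<Longrightarrow> f < length p \<Longrightarrow> eval p [u] (p ! f) v t \<Longrightarrow>
    eval p \<rho> (ECall f a) v (s + t + 1)"

lemma eval_deterministic:
  "eval p \<rho> e v t \<Longrightarrow> eval p \<rho> e v' t' \<Longrightarrow> v' = v \<and> t' = t"
proof (induction arbitrary: v' t' rule: eval.induct)
  case (Var i \<rho>)
  from Var.prems show ?case by cases simp_all
next
  case (Const \<rho> n)
  from Const.prems show ?case by cases simp_all
next
  case (Add \<rho> a m s b n t)
  from Add.prems show ?case by cases (use Add.IH in blast)
next
  case (Sub \<rho> a m s b n t)
  from Sub.prems show ?case by cases (use Sub.IH in blast)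
next
  case (Node \<rho> a u s b v t)
  from Node.prems show ?case by cases (use Node.IH in blast)
next
  case (Fst \<rho> a u v t)
  from Fst.prems show ?case by cases (use Fst.IH in blast)
next
  case (Snd \<rho> a u v t)
  from Snd.prems show ?case by cases (use Snd.IH in blast)
next
  case (If_nonzero \<rho> c u s a v t b)
  from If_nonzero.prems show ?case by cases (use If_nonzero.IH If_nonzero.hyps in blast)+
next
  case (If_zero \<rho> c s b v t a)
  from If_zero.prems show ?case by cases (use If_zero.IH in blast)+
next
  case (Let \<rho> a u s b v t)
  from Let.prems show ?case by cases (use Let.IH in blast)
next
  case (Call \<rho> a u s f v t)
  from Call.prems show ?case by cases (use Call.IH in blast)
qed

definition run :: "program \<Rightarrow> val \<Rightarrow> val \<Rightarrow> nat \<Rightarrow> bool" where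
  "run p x v t \<longleftrightarrow> p \<noteq> [] \<and> eval p [x] (p ! 0) v t"

fun val_size :: "val \<Rightarrow> nat" where
  "val_size (Num n) = floorlog 2 n + 1"
| "val_size (Node u v) = val_size u + val_size v + 1"

definition computable :: "(nat \<Rightarrow> nat) \<Rightarrow> bool" where
  "computable g \<longleftrightarrow> (\<exists>p. \<forall>n. \<exists>t. run p (Num n) (Num (g n)) t)"

text \<open>
  \<open>fpt_solvable I enc yes \<kappa>\<close>: the decision problem with instances \<open>I\<close> and yes-instances \<open>yes\<close> is
  solved by one program in time \<open>g(\<kappa>) \<cdot> poly(input size)\<close> with \<open>g\<close> computable.  An instance may have
  several encodings, and the program must be correct and meet the time bound on all of them.
\<close>

definition fpt_solvable ::
  "'i set \<Rightarrow> ('i \<Rightarrow> val \<Rightarrow> bool) \<Rightarrow> ('i \<Rightarrow> bool) \<Rightarrow> ('i \<Rightarrow> nat) \<Rightarrow> bool" where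
  "fpt_solvable I enc yes \<kappa> \<longleftrightarrow>
    (\<exists>p g (q :: nat poly). computable g \<and>
      (\<forall>i\<in>I. \<forall>x. enc i x \<longrightarrow>
        (\<exists>t. run p x (Num (if yes i then 1 else 0)) t \<and> t \<le> g (\<kappa> i) * poly q (val_size x))))"

section \<open>Graphs\<close>

definition simple_graph :: "'v set \<Rightarrow> 'v set set \<Rightarrow> bool" where
  "simple_graph V E \<longleftrightarrow> finite V \<and> (\<forall>e\<in>E. e \<subseteq> V \<and> card e = 2)"

definition bipartite :: "'v set \<Rightarrow> 'v set set \<Rightarrow> bool" where
  "bipartite V E \<longleftrightarrow>
    (\<exists>A B. A \<union> B = V \<and> A \<inter> B = {} \<and> (\<forall>e\<in>E. \<exists>a\<in>A. \<exists>b\<in>B. e = {a, b}))"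

definition covered_edges :: "'v set set \<Rightarrow> 'v set \<Rightarrow> 'v set set" where
  "covered_edges E V0 = {e \<in> E. e \<inter> V0 \<noteq> {}}"

definition matching :: "'v set set \<Rightarrow> bool" where
  "matching M \<longleftrightarrow> (\<forall>e\<in>M. \<forall>f\<in>M. e \<noteq> f \<longrightarrow> e \<inter> f = {})"

section \<open>The problem M-EPVCB\<close>

text \<open>Vertices are named by natural numbers, so that instances can be written down as inputs.\<close>

record mepvcb =
  verts :: "nat set"
  edges :: "nat set set"
  weight :: "nat set \<Rightarrow> nat"
  k1 :: nat
  k2 :: nat
  k3 :: nat

definition mepvcb_instance :: "mepvcb \<Rightarrow> bool" where
  "mepvcb_instance I \<longleftrightarrow>
    simple_graph (verts I) (edges I) \<and> bipartite (verts I) (edges I) \<and>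
    (\<forall>e\<in>edges I. weight I e > 0) \<and> k1 I > 0 \<and> k2 I > 0 \<and> k3 I > 0"

definition mepvcb_yes :: "mepvcb \<Rightarrow> bool" where
  "mepvcb_yes I \<longleftrightarrow>
    (\<exists>V0 \<subseteq> verts I. card V0 \<le> k1 I \<and>
      (\<Sum>e\<in>covered_edges (edges I) V0. weight I e) \<ge> k2 I \<and>
      (\<exists>M \<subseteq> covered_edges (edges I) V0. matching M \<and> (\<Sum>e\<in>M. weight I e) \<ge> k3 I))"

fun val_list :: "val list \<Rightarrow> val" where
  "val_list [] = Num 0"
| "val_list (v # vs) = Node v (val_list vs)"

text \<open>
  An input lists the vertices and the weighted edges \<open>(u, v, w {u, v})\<close>, each exactly once and in
  arbitrary order and orientation, followed by the three bounds.  All numbers count with their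
  binary length; the bipartition is not part of the input.
\<close>

definition mepvcb_encodes :: "mepvcb \<Rightarrow> val \<Rightarrow> bool" where
  "mepvcb_encodes I x \<longleftrightarrow>
    (\<exists>vs es.
      distinct vs \<and> set vs = verts I \<and>
      distinct (map (\<lambda>(u, v, c). {u, v}) es) \<and> set (map (\<lambda>(u, v, c). {u, v}) es) = edges I \<and>
      (\<forall>(u, v, c)\<in>set es. c = weight I {u, v}) \<and>
      x = val_list
        [val_list (map Num vs),
         val_list (map (\<lambda>(u, v, c). val_list [Num u, Num v, Num c]) es),
         Num (k1 I), Num (k2 I), Num (k3 I)])"

lemma mepvcb_encoding_exists:
  assumes "mepvcb_instance I"
  shows "\<exists>x. mepvcb_encodes I x"
proof -
  have sg: "simple_graph (verts I) (edges I)"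
    using assms by (simp add: mepvcb_instance_def)
  then have "finite (verts I)" by (simp add: simple_graph_def)
  then obtain vs where vs: "distinct vs" "set vs = verts I"
    using finite_distinct_list by blast
  have "edges I \<subseteq> Pow (verts I)" using sg by (auto simp: simple_graph_def)
  then have "finite (edges I)" using \<open>finite (verts I)\<close> finite_subset by blast
  then obtain ls where ls: "distinct ls" "set ls = edges I"
    using finite_distinct_list by blast
  have Min_Max: "{Min e, Max e} = e" if "e \<in> set ls" for e
  proof -
    have "card e = 2" using sg that ls(2) by (simp add: simple_graph_def)
    then obtain u v where "e = {u, v}" by (meson card_2_iff)
    then show ?thesis by (cases "u \<le> v") (auto simp: min_def max_def)
  qed
  define es where "es = map (\<lambda>e. (Min e, Max e, weight I e)) ls"
  have "map (\<lambda>(u, v, c). {u, v}) es = map (\<lambda>e. {Min e, Max e}) ls"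
    unfolding es_def by simp
  also have "\<dots> = ls"
    using Min_Max by (rule map_idI)
  finally have map_es: "map (\<lambda>(u, v, c). {u, v}) es = ls" .
  have "\<forall>(u, v, c)\<in>set es. c = weight I {u, v}"
    unfolding es_def by (auto simp: Min_Max)
  with vs ls map_es have "mepvcb_encodes I (val_list
      [val_list (map Num vs),
       val_list (map (\<lambda>(u, v, c). val_list [Num u, Num v, Num c]) es),
       Num (k1 I), Num (k2 I), Num (k3 I)])"
    unfolding mepvcb_encodes_def by (intro exI[of _ vs] exI[of _ es]) simp
  then show ?thesis ..
qed

end

theory Submission
  imports Defs
begin

text \<open>
  Since \<open>k\<^sub>3 \<le> k\<^sub>1\<close>, the two requirements decouple: an instance is a yes-instance iff some set of at
  most \<open>k\<^sub>1\<close> vertices covers weight at least \<open>k\<^sub>2\<close> and, independently, \<open>G\<close> has a matching of weight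
  at least \<open>k\<^sub>3\<close>. Indeed, take \<open>S\<close> of maximum coverage. If \<open>E(S)\<close> has no matching of size \<open>k\<^sub>3\<close>, then
  by Koenig's theorem fewer than \<open>k\<^sub>3 \<le> k\<^sub>1\<close> vertices cover \<open>E(S)\<close>; they must cover all of \<open>E\<close>, since
  adding an endpoint of an uncovered edge would beat \<open>S\<close>.

  Each requirement is decided by a bounded search tree: take the heaviest item (a vertex keyed by its
  weighted degree in the remaining graph, or an edge) or discard it. After \<open>2k\<close> consecutive
  discards of vertices, \<open>k\<close> of them lie on one side of the bipartition and are as good as anything that
  remains. After \<open>4k\<^sup>2\<close> consecutive discards of edges, the discarded edges contain a matching of
  size \<open>k\<close>, or a star so large that one of its edges can be exchanged into any small
  matching. Hence the search may stop after \<open>N = 2\<^bsup>2k+2\<^esup>\<close> consecutive discards.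
\<close>

section \<open>Decoupling the two requirements\<close>

text \<open>
  Koenig's theorem. In an edge-minimal graph of covering number \<open>n\<close>, let edges \<open>e \<noteq> f\<close> share \<open>x\<close>, and
  let \<open>S\<close>, \<open>T\<close> be covers of size below \<open>n\<close> of the graph without \<open>e\<close> and without \<open>f\<close>. Every edge meets
  \<open>S \<inter> T\<close> or lies within \<open>x\<close> and the symmetric difference of \<open>S\<close> and \<open>T\<close>, so \<open>S \<inter> T\<close> and the smaller
  colour class of the latter form too small a cover.
\<close>

lemma matching_of_cover_bound:
  assumes "finite E" "\<And>e. e \<in> E \<Longrightarrow> \<exists>a b. e = {a, b} \<and> side a \<and> \<not> side b"
    and "\<And>C. finite C \<Longrightarrow> \<forall>e\<in>E. e \<inter> C \<noteq> {} \<Longrightarrow> n \<le> card C"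
  shows "\<exists>M\<subseteq>E. matching M \<and> n \<le> card M"
  using assms
proof (induction "card E" arbitrary: E rule: less_induct)
  case less
  note fin = less.prems(1) and bip = less.prems(2) and cov = less.prems(3)
  show ?case
  \<comment> \<open>Either some edge is redundant, in that \<open>n\<close> still bounds all covers
    of the rest, and induction applies to the smaller graph; or \<open>E\<close> is edge-critical,
    and then \<open>E\<close> itself turns out to be a matching with at least \<open>n\<close>
    edges.\<close>
  proof (cases "\<exists>e\<in>E. \<forall>C. finite C \<and> (\<forall>g\<in>E - {e}. g \<inter> C \<noteq> {}) \<longrightarrow> n \<le> card C")
    case True
    then obtain e where e: "e \<in> E" "\<And>C. finite C \<Longrightarrow> \<forall>g\<in>E - {e}. g \<inter> C \<noteq> {} \<Longrightarrow> n \<le> card C"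
      by blast
    have "\<exists>M\<subseteq>E - {e}. matching M \<and> n \<le> card M"
    proof (rule less.hyps)
      show "card (E - {e}) < card E" using fin e(1) by (rule card_Diff1_less)
    qed (use fin bip e in auto)
    then show ?thesis by blast
  next
    case False
    have crit: "\<exists>C. finite C \<and> (\<forall>g\<in>E - {e}. g \<inter> C \<noteq> {}) \<and> card C < n" if "e \<in> E" for e
    proof (rule ccontr)
      assume "\<not> ?thesis"
      then have "\<forall>C. finite C \<and> (\<forall>g\<in>E - {e}. g \<inter> C \<noteq> {}) \<longrightarrow> n \<le> card C"
        by (auto simp: not_less)
      then show False using False that by blast
    qed
    have "matching E"
      unfolding matching_def
    proof (intro ballI impI, rule ccontr)
      fix e f assume ef: "e \<in> E" "f \<in> E" "e \<noteq> f" "e \<inter> f \<noteq> {}"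
      then obtain x where x: "x \<in> e" "x \<in> f" by blast
      obtain S where S: "finite S" "\<forall>g\<in>E - {e}. g \<inter> S \<noteq> {}" "card S < n"
        using crit[OF ef(1)] by blast
      obtain T where T: "finite T" "\<forall>g\<in>E - {f}. g \<inter> T \<noteq> {}" "card T < n"
        using crit[OF ef(2)] by blast
      have eS: "e \<inter> S = {}"
      proof (rule ccontr)
        assume "e \<inter> S \<noteq> {}"
        then have "\<forall>g\<in>E. g \<inter> S \<noteq> {}" using S(2) by (metis DiffI singletonD)
        then show False using cov[OF S(1)] S(3) by simp
      qed
      have fT: "f \<inter> T = {}"
      proof (rule ccontr)
        assume "f \<inter> T \<noteq> {}"
        then have "\<forall>g\<in>E. g \<inter> T \<noteq> {}" using T(2) by (metis DiffI singletonD)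
        then show False using cov[OF T(1)] T(3) by simp
      qed
      define D where "D = (S - T) \<union> (T - S)"
      define H where "H = insert x D"
      have xD: "x \<notin> D" using x eS fT by (auto simp: D_def)
      have finD: "finite D" using S T by (simp add: D_def)
      have cardD: "card D + 2 * card (S \<inter> T) = card S + card T"
      proof -
        have "card D = card (S - T) + card (T - S)"
          unfolding D_def using S T by (intro card_Un_disjoint) auto
        moreover have "card S = card (S - T) + card (S \<inter> T)"
          using card_Int_Diff[OF S(1), of T] by simp
        moreover have "card T = card (T - S) + card (S \<inter> T)"
          using card_Int_Diff[OF T(1), of S] by (simp add: Int_commute)
        ultimately show ?thesis by simp
      qed
      \<comment> \<open>An edge other than \<open>e\<close> and \<open>f\<close> meets both
        \<open>S\<close> and \<open>T\<close>, so if it misses their intersection, its ends lie in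
        \<open>S - T\<close> and \<open>T - S\<close>. The edge \<open>e\<close> misses
        \<open>S\<close> and joins \<open>x\<close> to a vertex of \<open>T - S\<close>;
        symmetrically for \<open>f\<close>.\<close>
      have cover: "g \<inter> (S \<inter> T) \<noteq> {} \<or> g \<subseteq> H" if g: "g \<in> E" for g
      proof -
        obtain a b where ab: "g = {a, b}" using bip[OF g] by blast
        have 1: "g \<inter> S \<noteq> {}" if "g \<noteq> e" using S(2) g that by blast
        have 2: "g \<inter> T \<noteq> {}" if "g \<noteq> f" using T(2) g that by blast
        consider "g = e" | "g = f" | "g \<noteq> e" "g \<noteq> f" by blast
        then show ?thesis
        proof cases
          case 1
          then show ?thesis using 2 ef(3) eS fT x ab by (auto simp: H_def D_def)
        next
          case c: 2
          then show ?thesis using 1 ef(3) eS fT x ab by (auto simp: H_def D_def)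
        next
          case 3
          then show ?thesis using 1 2 ab by (auto simp: H_def D_def)
        qed
      qed
      define P where "P = {v \<in> H. side v}"
      define Q where "Q = {v \<in> H. \<not> side v}"
      have finPQ: "finite P" "finite Q" using finD by (auto simp: P_def Q_def H_def)
      have "card P + card Q = card H"
      proof -
        have "P \<union> Q = H" "P \<inter> Q = {}" by (auto simp: P_def Q_def)
        then show ?thesis using card_Un_disjoint[OF finPQ] by simp
      qed
      then have PQ: "card P + card Q = card D + 1" using xD finD by (simp add: H_def)
      \<comment> \<open>Each edge has an end on either side, so an edge inside \<open>H\<close>
        meets \<open>P\<close> as well as \<open>Q\<close>.\<close>
      have cX: "n \<le> card (X \<union> (S \<inter> T))" if "X = P \<or> X = Q" for X
      proof (rule cov)
        show "finite (X \<union> (S \<inter> T))" using that finPQ S by auto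
        show "\<forall>g\<in>E. g \<inter> (X \<union> (S \<inter> T)) \<noteq> {}"
        proof
          fix g assume g: "g \<in> E"
          obtain a b where "g = {a, b}" "side a" "\<not> side b" using bip[OF g] by blast
          then show "g \<inter> (X \<union> (S \<inter> T)) \<noteq> {}"
            using cover[OF g] that by (auto simp: P_def Q_def)
        qed
      qed
      have "n \<le> card P + card (S \<inter> T)" "n \<le> card Q + card (S \<inter> T)"
        using cX[of P] cX[of Q] card_Un_le[of P "S \<inter> T"] card_Un_le[of Q "S \<inter> T"] by auto
      \<comment> \<open>The two bounds add up to \<open>2 * n\<close> on the left and to
        \<open>card S + card T + 1\<close>, at most \<open>2 * n - 1\<close>, on the right.\<close>
      then show False using PQ cardD S(3) T(3) by linarith
    qed
    \<comment> \<open>Picking one vertex from each edge yields a cover of at most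
      \<open>card E\<close> vertices.\<close>
    moreover have "n \<le> card E"
    proof -
      have ne: "\<exists>v. v \<in> e" if "e \<in> E" for e using bip[OF that] by blast
      have "n \<le> card ((\<lambda>e. SOME v. v \<in> e) ` E)"
      proof (rule cov)
        show "\<forall>e\<in>E. e \<inter> (\<lambda>e. SOME v. v \<in> e) ` E \<noteq> {}"
        proof
          fix e assume "e \<in> E"
          then have "(SOME v. v \<in> e) \<in> e" using someI_ex[OF ne] by simp
          then show "e \<inter> (\<lambda>e. SOME v. v \<in> e) ` E \<noteq> {}" using \<open>e \<in> E\<close> by auto
        qed
      qed (use fin in simp)
      then show ?thesis using card_image_le[OF fin] le_trans by blast
    qed
    ultimately show ?thesis by blast
  qed
qed

lemma covered_edges_subset: "covered_edges E C \<subseteq> E"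
  by (auto simp: covered_edges_def)

lemma mepvcb_yes_iff:
  assumes I: "mepvcb_instance I" and le: "k3 I \<le> k1 I"
  shows "mepvcb_yes I \<longleftrightarrow>
    (\<exists>S\<subseteq>verts I. card S \<le> k1 I \<and> k2 I \<le> sum (weight I) (covered_edges (edges I) S)) \<and>
    (\<exists>M\<subseteq>edges I. matching M \<and> k3 I \<le> sum (weight I) M)"
    (is "_ \<longleftrightarrow> ?A \<and> ?B")
proof
  assume "mepvcb_yes I"
  then obtain S M where S: "S \<subseteq> verts I" "card S \<le> k1 I"
      "k2 I \<le> sum (weight I) (covered_edges (edges I) S)"
    and M: "M \<subseteq> covered_edges (edges I) S" "matching M" "k3 I \<le> sum (weight I) M"
    unfolding mepvcb_yes_def by auto
  have "M \<subseteq> edges I" using M(1) covered_edges_subset by (rule order_trans)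
  with S M(2,3) show "?A \<and> ?B" by auto
next
  assume AB: "?A \<and> ?B"
  let ?V = "verts I" let ?E = "edges I" let ?w = "weight I"
  let ?cov = "\<lambda>S. sum ?w (covered_edges ?E S)"
  have finV: "finite ?V" and EV: "\<And>e. e \<in> ?E \<Longrightarrow> e \<subseteq> ?V"
    using I by (auto simp: mepvcb_instance_def simple_graph_def)
  have finE: "finite ?E" using EV finV by (intro finite_subset[of ?E "Pow ?V"]) auto
  have fincov: "finite (covered_edges ?E S)" for S
    using finE covered_edges_subset by (rule finite_subset[rotated])
  have pos: "?w e \<ge> 1" if "e \<in> ?E" for e using I that by (auto simp: mepvcb_instance_def Suc_le_eq)
  obtain A B where AB': "A \<union> B = ?V" "A \<inter> B = {}" "\<forall>e\<in>?E. \<exists>a\<in>A. \<exists>b\<in>B. e = {a, b}"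
    using I by (auto simp: mepvcb_instance_def bipartite_def)
  obtain S0 where S0: "S0 \<subseteq> ?V" "card S0 \<le> k1 I" "k2 I \<le> ?cov S0" using AB by blast
  obtain S where S: "S \<subseteq> ?V" "card S \<le> k1 I"
    and opt: "\<And>T. T \<subseteq> ?V \<Longrightarrow> card T \<le> k1 I \<Longrightarrow> ?cov T \<le> ?cov S"
  proof -
    let ?F = "{T. T \<subseteq> ?V \<and> card T \<le> k1 I}"
    have "finite (?cov ` ?F)" using finV by simp
    moreover have "?cov ` ?F \<noteq> {}" using S0 by blast
    ultimately have "Max (?cov ` ?F) \<in> ?cov ` ?F" by (rule Max_in)
    then obtain T where T: "T \<in> ?F" "Max (?cov ` ?F) = ?cov T" by (rule imageE) auto
    show ?thesis
    proof (rule that)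
      fix R assume "R \<subseteq> ?V" "card R \<le> k1 I"
      then have "?cov R \<le> Max (?cov ` ?F)" using finV by (intro Max_ge) auto
      then show "?cov R \<le> ?cov T" using T(2) by simp
    qed (use T in auto)
  qed
  show "mepvcb_yes I"
  proof (cases "\<exists>M\<subseteq>covered_edges ?E S. matching M \<and> k3 I \<le> card M")
    case True
    then obtain M where M: "M \<subseteq> covered_edges ?E S" "matching M" "k3 I \<le> card M" by blast
    have "M \<subseteq> ?E" using M(1) by (auto simp: covered_edges_def)
    then have "card M \<le> sum ?w M"
      using sum_mono[of M "\<lambda>_. 1" ?w] pos by auto
    then have "k3 I \<le> sum ?w M" using M(3) by linarith
    moreover have "k2 I \<le> ?cov S" using S0(3) opt[OF S0(1,2)] by simp
    ultimately show ?thesis unfolding mepvcb_yes_def using S M by blast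
  next
    case False
    have "\<exists>C. finite C \<and> (\<forall>e\<in>covered_edges ?E S. e \<inter> C \<noteq> {}) \<and> card C < k3 I"
    proof (rule ccontr)
      assume *: "\<not> ?thesis"
      have "\<exists>M\<subseteq>covered_edges ?E S. matching M \<and> k3 I \<le> card M"
      proof (rule matching_of_cover_bound[OF fincov, where side = "\<lambda>v. v \<in> A"])
        fix e assume "e \<in> covered_edges ?E S"
        then have "e \<in> ?E" by (simp add: covered_edges_def)
        then obtain a b where "a \<in> A" "b \<in> B" "e = {a, b}" using AB'(3) by blast
        then show "\<exists>a b. e = {a, b} \<and> a \<in> A \<and> b \<notin> A" using AB'(2) by auto
      next
        fix C assume "finite C" "\<forall>e\<in>covered_edges ?E S. e \<inter> C \<noteq> {}"
        then show "k3 I \<le> card C" using * not_le by blast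
      qed
      with False show False ..
    qed
    then obtain C' where C': "finite C'" "\<forall>e\<in>covered_edges ?E S. e \<inter> C' \<noteq> {}" "card C' < k3 I"
      by blast
    \<comment> \<open>A solution must consist of vertices of the graph. All edges lie inside
      \<open>?V\<close>, so the restriction is still a cover.\<close>
    define C where "C = C' \<inter> ?V"
    have C: "C \<subseteq> ?V" "finite C" "card C < k3 I"
      using C' card_mono[of C' C] by (auto simp: C_def)
    have CS: "\<forall>e\<in>covered_edges ?E S. e \<inter> C \<noteq> {}"
      using C'(2) EV unfolding C_def covered_edges_def by blast
    have sub: "covered_edges ?E S \<subseteq> covered_edges ?E C"
      using CS by (auto simp: covered_edges_def)
    have "covered_edges ?E C = ?E"
    proof (rule ccontr)
      assume "covered_edges ?E C \<noteq> ?E"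
      then obtain e where e: "e \<in> ?E" "e \<inter> C = {}" by (auto simp: covered_edges_def)
      then obtain a b where "e = {a, b}" using AB'(3) by blast
      then have a: "a \<in> e" "a \<in> ?V" using EV[OF e(1)] by auto
      have "e \<notin> covered_edges ?E S" using CS e(2) by blast
      then have "?cov S < sum ?w (insert e (covered_edges ?E S))"
        using pos[OF e(1)] fincov by simp
      also have "\<dots> \<le> ?cov (insert a C)"
        using sub e a fincov by (intro sum_mono2 fincov) (auto simp: covered_edges_def)
      \<comment> \<open>Here \<open>k3 I \<le> k1 I\<close> enters: \<open>insert a C\<close> has at
        most \<open>k3 I\<close> vertices, so it competes with the optimal \<open>S\<close>.\<close>
      also have "\<dots> \<le> ?cov S"
        using C a le by (intro opt) (auto simp: card_insert_if)
      finally show False by simp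
    qed
    moreover have "?cov S0 \<le> sum ?w ?E" by (intro sum_mono2 finE covered_edges_subset) auto
    \<comment> \<open>Since \<open>C\<close> covers every edge, its weight is maximal and the
      matching supplied by \<open>?B\<close> lies among the covered edges.\<close>
    ultimately show ?thesis
      unfolding mepvcb_yes_def using AB C le S0(3) by (intro exI[of _ C]) auto
  qed
qed

section \<open>The search tree\<close>

text \<open>
  An item \<open>(a, b, c)\<close> is either an edge \<open>{a, b}\<close> of weight \<open>c\<close> or, with \<open>a = b\<close>, a vertex of weighted
  degree \<open>c\<close>, so that both searches can share one procedure.
\<close>

type_synonym item = "nat \<times> nat \<times> nat"

text \<open>A single pass is enough: a node of the search tree needs a heaviest item at the head,
  and the order of the tail is irrelevant.\<close>

fun bubble :: "item list \<Rightarrow> item list" where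
  "bubble [] = []"
| "bubble (x # xs) = (case bubble xs of [] \<Rightarrow> [x]
    | m # r \<Rightarrow> if snd (snd x) < snd (snd m) then m # x # r else x # m # r)"

fun remv :: "nat \<Rightarrow> item list \<Rightarrow> item list" where
  "remv x [] = []"
| "remv x ((a, b, c) # es) = (if a = x \<or> b = x then remv x es else (a, b, c) # remv x es)"

fun deg :: "nat \<Rightarrow> item list \<Rightarrow> nat" where
  "deg x [] = 0"
| "deg x ((a, b, c) # es) = (if a = x \<or> b = x then c + deg x es else deg x es)"

text \<open>Recomputing the keys in the graph left after a selection prevents edges already covered
  from being counted again. The vertex is repeated so that deleting both ends of an item deletes
  just this vertex.\<close>

definition rekey :: "item list \<Rightarrow> item list \<Rightarrow> item list" where
  "rekey es = map (\<lambda>(a, b, c). (a, a, deg a es))"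

abbreviation vertex_items :: "nat list \<Rightarrow> item list" where
  "vertex_items \<equiv> map (\<lambda>v. (v, v, 0))"

text \<open>
  \<open>vm\<close> distinguishes the search for a vertex set (\<open>ts\<close> are vertices of the graph \<open>es\<close>) from the search
  for a matching (\<open>ts\<close> are edges and \<open>es\<close> is irrelevant); \<open>k\<close> items may still be taken, \<open>d\<close> discarded
  before the next one is taken, and \<open>t\<close> is the weight still required.
\<close>

fun srec :: "bool \<Rightarrow> nat \<Rightarrow> nat \<Rightarrow> nat \<Rightarrow> item list \<Rightarrow> item list \<Rightarrow> nat \<Rightarrow> bool" where
  "srec vm N k d ts es t =
    (if t = 0 then True
     else if k = 0 \<or> d = 0 then False
     else case bubble ts of [] \<Rightarrow> False
      | (a, b, c) # r \<Rightarrow>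
        (let es' = remv a (remv b es);
             ts' = (if vm then rekey es' r else remv a (remv b r))
         in srec vm N (k - 1) N ts' es' (t - c) \<or> srec vm N k (d - 1) r es t))"

declare srec.simps [simp del]

section \<open>Basic properties of the search and induction over it\<close>

lemma length_bubble [simp]: "length (bubble ts) = length ts"
  by (induction ts) (auto split: list.split)

lemma mset_bubble [simp]: "mset (bubble ts) = mset ts"
  by (induction ts) (auto split: list.split)

lemma set_bubble [simp]: "set (bubble ts) = set ts"
  by (metis mset_bubble set_mset_mset)

text \<open>Lexicographic induction on \<open>(k, d)\<close>: a selection lowers \<open>k\<close>
  and may reset \<open>d\<close>, a discard lowers \<open>d\<close> only. The lists and the target
  stay arbitrary.\<close>

lemma srec_induct [case_names step]:
  assumes "\<And>k d ts es t. (\<And>d ts es t. 0 < k \<Longrightarrow> P (k - 1) d ts es t) \<Longrightarrow>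
      (\<And>ts es t. 0 < d \<Longrightarrow> P k (d - 1) ts es t) \<Longrightarrow> P k d ts es t"
  shows "P (k :: nat) (d :: nat) ts es t"
proof (induction k arbitrary: d ts es t rule: less_induct)
  case (less k d ts es t)
  note outer = this
  show ?case
  proof (induction d arbitrary: ts es t rule: less_induct)
    case (less d ts es t)
    show ?case by (rule assms) (use outer less in auto)
  qed
qed

lemma bubble_max: "bubble ts = m # r \<Longrightarrow> x \<in> set r \<Longrightarrow> snd (snd x) \<le> snd (snd m)"
  by (induction ts arbitrary: m r x) (fastforce split: list.splits if_splits)+

lemma set_bubble_Cons: "bubble ts = m # r \<Longrightarrow> set ts = insert m (set r)"
  by (metis set_bubble list.simps(15))

lemma distinct_bubble_Cons: "bubble ts = m # r \<Longrightarrow> distinct (map f ts) \<longleftrightarrow> distinct (map f (m # r))"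
  by (metis mset_bubble mset_map mset_eq_imp_distinct_iff)

section \<open>Covered weight and weighted degrees\<close>

fun cov :: "nat set \<Rightarrow> item list \<Rightarrow> nat" where
  "cov S [] = 0"
| "cov S ((a, b, c) # es) = (if a \<in> S \<or> b \<in> S then c + cov S es else cov S es)"

lemma cov_empty [simp]: "cov {} es = 0"
  by (induction "{} :: nat set" es rule: cov.induct) auto

lemma remv_remv [simp]: "remv x (remv x es) = remv x es"
  by (induction x es rule: remv.induct) auto

lemma set_remv: "set (remv x es) = {(a, b, c) \<in> set es. a \<noteq> x \<and> b \<noteq> x}"
  by (induction x es rule: remv.induct) auto

lemma distinct_remv: "distinct es \<Longrightarrow> distinct (remv x es)"
  by (induction x es rule: remv.induct) (auto simp: set_remv)

text \<open>This identity justifies the selection step of the vertex search, which subtracts the key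
  of \<open>v\<close> from the target and continues in the graph without \<open>v\<close>.\<close>

lemma cov_insert: "cov (insert v S) es = deg v es + cov S (remv v es)"
  by (induction v es rule: remv.induct) auto

lemma cov_remv_le: "cov S (remv v es) \<le> cov S es"
  by (induction v es rule: remv.induct) auto

lemma cov_le_sum_deg: "finite S \<Longrightarrow> cov S es \<le> (\<Sum>v\<in>S. deg v es)"
proof (induction S rule: finite_induct)
  case (insert v S)
  then show ?case using cov_remv_le[of S v es] by (simp add: cov_insert)
qed simp

lemma cov_remv_eq:
  "\<forall>(a, b, c)\<in>set es. a = v \<or> b = v \<longrightarrow> a \<notin> S \<and> b \<notin> S \<Longrightarrow> cov S (remv v es) = cov S es"
  by (induction v es rule: remv.induct) auto

text \<open>Without edges inside \<open>S\<close> no edge is counted twice, so the bound of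
  \<open>cov_le_sum_deg\<close> is attained. Sets on one side of the bipartition are of this
  kind.\<close>

lemma cov_independent:
  "finite S \<Longrightarrow> \<forall>(a, b, c)\<in>set es. \<not> (a \<in> S \<and> b \<in> S) \<Longrightarrow> cov S es = (\<Sum>v\<in>S. deg v es)"
proof (induction S rule: finite_induct)
  case (insert v S)
  have "cov S (remv v es) = cov S es"
    using insert.prems insert.hyps(2) by (intro cov_remv_eq) auto
  moreover have "cov S es = (\<Sum>v\<in>S. deg v es)" using insert.prems by (intro insert.IH) auto
  ultimately show ?case using insert.hyps by (simp add: cov_insert)
qed simp

text \<open>Pigeonhole on the two sides; applied to the discarded vertices.\<close>

lemma monochromatic_subset:
  fixes side :: "'a \<Rightarrow> bool"
  assumes "finite D" "2 * k \<le> card D"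
  shows "\<exists>I\<subseteq>D. card I = k \<and> (\<forall>x\<in>I. \<forall>y\<in>I. side x = side y)"
proof -
  let ?P = "{x \<in> D. side x}" and ?Q = "{x \<in> D. \<not> side x}"
  have "card ?P + card ?Q = card (?P \<union> ?Q)"
    using assms(1) by (intro card_Un_disjoint[symmetric]) auto
  also have "?P \<union> ?Q = D" by auto
  finally consider "k \<le> card ?P" | "k \<le> card ?Q" using assms(2) by linarith
  then show ?thesis
  proof cases
    case 1
    then obtain I where "I \<subseteq> ?P" "card I = k" by (rule obtain_subset_with_card_n)
    then show ?thesis by (intro exI[of _ I]) auto
  next
    case 2
    then obtain I where "I \<subseteq> ?Q" "card I = k" by (rule obtain_subset_with_card_n)
    then show ?thesis by (intro exI[of _ I]) auto
  qed
qed

lemma sum_le_sum_of_card_le: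
  fixes f :: "'a \<Rightarrow> nat"
  assumes "finite S" "finite I" "card S \<le> card I" "\<And>s x. s \<in> S \<Longrightarrow> x \<in> I \<Longrightarrow> f s \<le> f x"
  shows "sum f S \<le> sum f I"
proof (cases "I = {}")
  case True
  then show ?thesis using assms by simp
next
  case False
  \<comment> \<open>The least value on \<open>I\<close> separates the two sums: it bounds every term
    of the first from above and every term of the second from below.\<close>
  define m where "m = Min (f ` I)"
  have m: "m \<in> f ` I" unfolding m_def using assms(2) False by (intro Min_in) auto
  have "sum f S \<le> card S * m" using assms(4) m
      by (intro sum_bounded_above[where K = m, simplified]) auto
  also have "\<dots> \<le> card I * m" using assms(3) by simp
  also have "\<dots> \<le> sum f I"
    using assms(2) by (intro sum_bounded_below[where K = m, simplified]) (auto simp: m_def)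
  finally show ?thesis .
qed

lemma srec_0 [simp]: "srec vm N k d ts es 0"
  by (simp add: srec.simps)

lemma srec_bubble_Cons:
  assumes "bubble ts = (a, b, c) # r" "0 < t" "0 < k" "0 < d"
  shows "srec vm N k d ts es t \<longleftrightarrow>
    srec vm N (k - 1) N (if vm then rekey (remv a (remv b es)) r else remv a (remv b r))
      (remv a (remv b es)) (t - c) \<or> srec vm N k (d - 1) r es t"
  using assms by (subst srec.simps) (simp add: Let_def)

lemma srecE:
  assumes "srec vm N k d ts es t"
  obtains "t = 0"
  | a b c r where "0 < t" "0 < k" "0 < d" "bubble ts = (a, b, c) # r"
  using assms by (subst (asm) srec.simps) (auto split: if_splits list.splits)

section \<open>Correctness of the search for a vertex set\<close>

lemma set_rekey: "set (rekey es ts) = (\<lambda>a. (a, a, deg a es)) ` fst ` set ts"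
  by (force simp: rekey_def image_iff)

lemma fst_rekey [simp]: "map fst (rekey es ts) = map fst ts"
  by (auto simp: rekey_def)

lemma fst_set_rekey [simp]: "fst ` set (rekey es ts) = fst ` set ts"
  by (metis fst_rekey list.set_map)

text \<open>Keys remain current degrees: \<open>rekey\<close> restores this after a selection, and a
  discard leaves \<open>es\<close> alone. A set found after selecting \<open>a\<close> is enlarged
  by \<open>a\<close>, with \<open>cov_insert\<close> accounting for the weight.\<close>

lemma srec_vertex_sound:
  assumes "srec True N k d ts es t" "\<forall>(a, b, c)\<in>set ts. a = b \<and> c = deg a es"
  shows "\<exists>S\<subseteq>fst ` set ts. card S \<le> k \<and> t \<le> cov S es"
  using assms
proof (induction k d ts es t rule: srec_induct)
  case (step k d ts es t)
  from step.prems(1) show ?case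
  proof (cases rule: srecE)
    case 1
    then show ?thesis by auto
  next
    case (2 a b c r)
    have ab: "b = a" "c = deg a es"
      using step.prems(2) set_bubble_Cons[OF 2(4)] by auto
    let ?es = "remv a es"
    have r: "\<forall>(a, b, c)\<in>set r. a = b \<and> c = deg a es" and sub: "fst ` set r \<subseteq> fst ` set ts"
      and a: "a \<in> fst ` set ts"
      using step.prems(2) set_bubble_Cons[OF 2(4)] by auto
    consider "srec True N (k - 1) N (rekey ?es r) ?es (t - c)" | "srec True N k (d - 1) r es t"
      using step.prems(1) srec_bubble_Cons[OF 2(4,1,2,3)] ab by auto
    then show ?thesis
    proof cases
      case 1
      have "\<exists>S\<subseteq>fst ` set (rekey ?es r). card S \<le> k - 1 \<and> t - c \<le> cov S ?es"
        using 1 2 by (intro step.IH(1)) (auto simp: set_rekey)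
      then obtain S where S: "S \<subseteq> fst ` set r" "card S \<le> k - 1" "t - c \<le> cov S ?es" by auto
      then have "finite S" using finite_subset by blast
      then have "card (insert a S) \<le> k" using S(2) 2(2) by (auto simp: card_insert_if)
      moreover have "t \<le> cov (insert a S) es" using S(3) ab by (simp add: cov_insert)
      ultimately show ?thesis using S(1) sub a by (intro exI[of _ "insert a S"]) auto
    next
      case c: 2
      have "\<exists>S\<subseteq>fst ` set r. card S \<le> k \<and> t \<le> cov S es"
        using c r 2 by (intro step.IH(2)) auto
      then obtain S where "S \<subseteq> fst ` set r" "card S \<le> k" "t \<le> cov S es" by auto
      then show ?thesis using sub by (intro exI[of _ S]) simp
    qed
  qed
qed

text \<open>
  \<open>D\<close> collects the vertices discarded since the last selection; the search may assume that no
  good set meets \<open>D\<close>, as that set would have been found earlier. Among \<open>2k\<close> discarded vertices,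
  \<open>k\<close> lie on one side, and these cover at least as much as any \<open>k\<close> of the remaining vertices.
\<close>

lemma srec_vertex_complete:
  fixes side :: "nat \<Rightarrow> bool"
  assumes "\<forall>(a, b, c)\<in>set es. side a \<noteq> side b"
    and "\<forall>(a, b, c)\<in>set ts. a = b \<and> c = deg a es" "distinct (map fst ts)"
    and "finite D" "D \<inter> fst ` set ts = {}" "\<forall>x\<in>D. \<forall>v\<in>fst ` set ts. deg v es \<le> deg x es"
    and "2 * k \<le> card D + d" "2 * k \<le> N"
    and "\<forall>S\<subseteq>D \<union> fst ` set ts. card S \<le> k \<and> t \<le> cov S es \<longrightarrow> S \<inter> D = {}"
    and "\<exists>S\<subseteq>fst ` set ts. card S \<le> k \<and> t \<le> cov S es"
  shows "srec True N k d ts es t"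
  using assms
proof (induction k d ts es t arbitrary: D rule: srec_induct)
  case (step k d ts es t)
  note bip = step.prems(1) and ts = step.prems(2) and dist = step.prems(3) and finD = step.prems(4)
    and disj = step.prems(5) and dom = step.prems(6) and cardD = step.prems(7)
    and kN = step.prems(8) and none = step.prems(9)
  obtain S where S: "S \<subseteq> fst ` set ts" "card S \<le> k" "t \<le> cov S es" using step.prems(10) by blast
  have finS: "finite S" using S(1) finite_subset by blast
  show ?case
  proof (cases "t = 0")
    case False
    then have t: "0 < t" by simp
    have "S \<noteq> {}" using S(3) t by auto
    then have k: "0 < k" using S(2) finS by (metis card_gt_0_iff le_zero_eq neq0_conv)
    have d: "0 < d"
    proof (rule ccontr)
      assume "\<not> 0 < d"
      then have "2 * k \<le> card D" using cardD by simp
      then obtain I where I: "I \<subseteq> D" "card I = k" "\<forall>x\<in>I. \<forall>y\<in>I. side x = side y"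
        using monochromatic_subset[OF finD, of k side] by auto
      have finI: "finite I" using I(1) finD finite_subset by blast
      have "cov S es \<le> (\<Sum>v\<in>S. deg v es)" by (rule cov_le_sum_deg[OF finS])
      also have "\<dots> \<le> (\<Sum>v\<in>I. deg v es)"
        using finS finI S(1,2) I(1,2) dom by (intro sum_le_sum_of_card_le) auto
      also have "\<dots> = cov I es"
      proof (rule cov_independent[OF finI, symmetric])
        show "\<forall>(a, b, c)\<in>set es. \<not> (a \<in> I \<and> b \<in> I)"
        proof (clarify)
          fix a b c assume "(a, b, c) \<in> set es" "a \<in> I" "b \<in> I"
          then have "side a \<noteq> side b" "side a = side b" using bip I(3) by blast+
          then show False by simp
        qed
      qed
      \<comment> \<open>\<open>I\<close> is a good set inside \<open>D\<close>, whereas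
        \<open>none\<close> forbids good sets to meet \<open>D\<close>; so \<open>I\<close> would be
        empty although \<open>k\<close> is positive.\<close>
      finally have "I \<inter> D = {}" using none I(1,2) S(3) by auto
      then have "I = {}" using I(1) by blast
      then show False using I(2) k by simp
    qed
    obtain a b c r where bubble: "bubble ts = (a, b, c) # r"
    proof (cases "bubble ts")
      case Nil
      then have "length (bubble ts) = 0" by simp
      then show ?thesis using \<open>S \<noteq> {}\<close> S(1) by simp
    next
      case (Cons m r)
      then show ?thesis using that by (cases m) auto
    qed
    note set_ts = set_bubble_Cons[OF bubble]
    have ab: "b = a" "c = deg a es" using ts set_ts by auto
    have ts_r: "\<forall>(a, b, c)\<in>set r. a = b \<and> c = deg a es" using ts set_ts by auto
    have dist_r: "distinct (map fst r)" "a \<notin> fst ` set r"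
      using dist distinct_bubble_Cons[OF bubble, of fst] by auto
    let ?es = "remv a es"
    show ?thesis
    \<comment> \<open>If some good set uses the heaviest vertex \<open>a\<close>, the selecting
      branch succeeds, restarting with \<open>D = {}\<close> and the full budget \<open>N\<close>.
      Otherwise \<open>a\<close> joins \<open>D\<close>, and the assumption that no good set meets
      \<open>D\<close> survives.\<close>
    proof (cases "\<exists>S\<subseteq>fst ` set ts. a \<in> S \<and> card S \<le> k \<and> t \<le> cov S es")
      case True
      then obtain S where S: "S \<subseteq> fst ` set ts" "a \<in> S" "card S \<le> k" "t \<le> cov S es" by blast
      have finS: "finite S" using S(1) finite_subset by blast
      have "cov S es = deg a es + cov (S - {a}) ?es"
        using cov_insert[of a "S - {a}" es] S(2) by (simp add: insert_absorb)
      then have S': "S - {a} \<subseteq> fst ` set r" "card (S - {a}) \<le> k - 1" "t - c \<le> cov (S - {a}) ?es"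
        using S set_ts finS ab by auto
      have "srec True N (k - 1) N (rekey ?es r) ?es (t - c)"
      proof (rule step.IH(1)[OF k, where D = "{}"])
        show "\<forall>(a, b, c)\<in>set ?es. side a \<noteq> side b" using bip by (auto simp: set_remv)
        show "\<exists>S\<subseteq>fst ` set (rekey ?es r). card S \<le> k - 1 \<and> t - c \<le> cov S ?es"
          using S' by auto
      qed (use kN dist_r in \<open>auto simp: set_rekey\<close>)
      then show ?thesis using srec_bubble_Cons[OF bubble t k d] ab by simp
    next
      case False
      have max: "deg v es \<le> deg a es" if v: "v \<in> fst ` set r" for v
      proof -
        obtain b' c' where "(v, b', c') \<in> set r" using v by auto
        then show ?thesis using bubble_max[OF bubble] ts_r ab by fastforce
      qed
      have "a \<notin> D" using disj set_ts by auto
      have "srec True N k (d - 1) r es t"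
      proof (rule step.IH(2)[OF d, where D = "insert a D"])
        show "\<forall>x\<in>insert a D. \<forall>v\<in>fst ` set r. deg v es \<le> deg x es"
          using max dom set_ts by auto
        show "2 * k \<le> card (insert a D) + (d - 1)"
          using cardD finD d \<open>a \<notin> D\<close> by simp
        have eq: "insert a D \<union> fst ` set r = D \<union> fst ` set ts" using set_ts by auto
        show "\<forall>S\<subseteq>insert a D \<union> fst ` set r. card S \<le> k \<and> t \<le> cov S es \<longrightarrow> S \<inter> insert a D = {}"
          unfolding eq
        proof (intro allI impI)
          fix S assume S: "S \<subseteq> D \<union> fst ` set ts" "card S \<le> k \<and> t \<le> cov S es"
          then have "S \<inter> D = {}" using none by blast
          moreover from this have "S \<subseteq> fst ` set ts" using S(1) by blast
          then have "a \<notin> S" using False S(2) by blast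
          ultimately show "S \<inter> insert a D = {}" by simp
        qed
        have "a \<notin> S" using False S by blast
        then have "S \<subseteq> fst ` set r" using S(1) set_ts by auto
        then show "\<exists>S\<subseteq>fst ` set r. card S \<le> k \<and> t \<le> cov S es" using S by blast
        show "insert a D \<inter> fst ` set r = {}" using disj set_ts dist_r by auto
      qed (use bip ts_r dist_r finD kN in auto)
      then show ?thesis using srec_bubble_Cons[OF bubble t k d] by simp
    qed
  qed simp
qed

section \<open>Correctness of the search for a matching\<close>

definition ends :: "item \<Rightarrow> nat set" where
  "ends e = {fst e, fst (snd e)}"

definition wt :: "item \<Rightarrow> nat" where
  "wt e = snd (snd e)"

text \<open>The counterpart of \<open>matching\<close> for items; the two agree wherever
  \<open>ends\<close> is injective.\<close>

definition disj_ends :: "item set \<Rightarrow> bool" where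
  "disj_ends M \<longleftrightarrow> (\<forall>e\<in>M. \<forall>f\<in>M. e \<noteq> f \<longrightarrow> ends e \<inter> ends f = {})"

lemma disj_ends_subset: "disj_ends M \<Longrightarrow> M' \<subseteq> M \<Longrightarrow> disj_ends M'"
  unfolding disj_ends_def by blast

lemma disj_ends_insert:
  "disj_ends (insert e M) \<longleftrightarrow> disj_ends M \<and> (\<forall>f\<in>M. e \<noteq> f \<longrightarrow> ends e \<inter> ends f = {})"
  (is "?L \<longleftrightarrow> ?R")
proof
  assume ?R
  show ?L
    unfolding disj_ends_def
  proof (intro ballI impI)
    fix x y assume xy: "x \<in> insert e M" "y \<in> insert e M" "x \<noteq> y"
    then consider "x = e" "y \<in> M" | "y = e" "x \<in> M" | "x \<in> M" "y \<in> M" by blast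
    then show "ends x \<inter> ends y = {}"
    proof cases
      case 2
      then have "ends y \<inter> ends x = {}" using \<open>?R\<close> xy(3) by simp
      then show ?thesis by (simp add: Int_commute)
    qed (use \<open>?R\<close> xy(3) in \<open>auto simp: disj_ends_def\<close>)
  qed
qed (simp add: disj_ends_def)

lemma set_remv_ends: "set (remv x es) = {e \<in> set es. x \<notin> ends e}"
  by (auto simp: set_remv ends_def)

lemma set_remv2_ends:
  "set (remv a (remv b es)) = {e \<in> set es. ends (a, b, c) \<inter> ends e = {}}"
  by (auto simp: set_remv_ends ends_def)

text \<open>A selection deletes all items that touch the selected edge, so a matching found
  afterwards can be extended by that edge.\<close>

lemma srec_edge_sound:
  assumes "srec False N k d ts es t"
  shows "\<exists>M\<subseteq>set ts. disj_ends M \<and> t \<le> sum wt M"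
  using assms
proof (induction k d ts es t rule: srec_induct)
  case (step k d ts es t)
  from step.prems(1) show ?case
  proof (cases rule: srecE)
    case 1
    then show ?thesis by (intro exI[of _ "{}"]) (simp add: disj_ends_def)
  next
    case (2 a b c r)
    note set_ts = set_bubble_Cons[OF 2(4)]
    let ?r = "remv a (remv b r)"
    consider "srec False N (k - 1) N ?r (remv a (remv b es)) (t - c)"
      | "srec False N k (d - 1) r es t"
      using step.prems(1) srec_bubble_Cons[OF 2(4,1,2,3)] by auto
    then show ?thesis
    proof cases
      case 1
      have "\<exists>M\<subseteq>set ?r. disj_ends M \<and> t - c \<le> sum wt M"
        by (rule step.IH(1)[OF 2(2) 1])
      then obtain M where M: "M \<subseteq> set ?r" "disj_ends M" "t - c \<le> sum wt M" by auto
      have sep: "ends (a, b, c) \<inter> ends f = {}" "f \<in> set ts" if "f \<in> M" for f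
        using M(1) that set_ts by (auto simp: set_remv2_ends[where c = c])
      have "(a, b, c) \<notin> M" using sep(1)[of "(a, b, c)"] by (auto simp: ends_def)
      moreover have "finite M" using M(1) finite_subset by blast
      ultimately have "t \<le> sum wt (insert (a, b, c) M)" using M(3) by (simp add: wt_def)
      moreover have "disj_ends (insert (a, b, c) M)"
        using M(2) sep(1) by (simp add: disj_ends_insert)
      ultimately show ?thesis using sep(2) set_ts by (intro exI[of _ "insert (a, b, c) M"]) auto
    next
      case c: 2
      have "\<exists>M\<subseteq>set r. disj_ends M \<and> t \<le> sum wt M" by (rule step.IH(2)[OF 2(3) c])
      then obtain M where "M \<subseteq> set r" "disj_ends M" "t \<le> sum wt M" by auto
      then show ?thesis using set_ts by (intro exI[of _ M]) auto
    qed
  qed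
qed

lemma card_le_sum_wt:
  assumes "\<forall>e\<in>M. 1 \<le> wt e"
  shows "card M \<le> sum wt M"
  using sum_mono[of M "\<lambda>_. 1" wt] assms by simp

text \<open>As every weight is at least 1, any \<open>t\<close> edges already weigh
  \<open>t\<close>. This limits the number of endpoints that an exchange has to avoid.\<close>

lemma small_heavy_subset:
  assumes "\<forall>e\<in>M. 1 \<le> wt e" "t \<le> sum wt M"
  shows "\<exists>M'\<subseteq>M. card M' \<le> t \<and> t \<le> sum wt M'"
proof (cases "card M \<le> t")
  case False
  then obtain M' where M': "M' \<subseteq> M" "card M' = t"
    using obtain_subset_with_card_n[of t M] by (metis nat_le_linear)
  then have "t \<le> sum wt M'" using card_le_sum_wt[of M'] assms(1) by auto
  then show ?thesis using M' by auto
qed (use assms in auto)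

lemma card_ends_le: "card (ends e) \<le> 2"
  by (simp add: ends_def card_insert_if)

lemma card_Union_ends_le:
  assumes "finite M"
  shows "card (\<Union> (ends ` M)) \<le> 2 * card M"
proof -
  have "card (\<Union> (ends ` M)) \<le> (\<Sum>e\<in>M. card (ends e))" by (rule card_UN_le[OF assms])
  also have "\<dots> \<le> (\<Sum>e\<in>M. 2)" by (intro sum_mono card_ends_le)
  finally show ?thesis by simp
qed

text \<open>The endpoints of a maximum matching of \<open>D\<close> hit all of \<open>D\<close>. If
  it has fewer than \<open>k\<close> edges and every vertex lies on at most \<open>m\<close> edges,
  then \<open>D\<close> has fewer than \<open>2 * k * m\<close> elements.\<close>

lemma matching_or_star:
  assumes D: "finite D" "2 * k * m \<le> card D" and k: "0 < k" and m: "0 < m"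
  shows "(\<exists>Q\<subseteq>D. disj_ends Q \<and> k \<le> card Q) \<or> (\<exists>u. m < card {e \<in> D. u \<in> ends e})"
proof (rule ccontr)
  assume "\<not> ?thesis"
  then have noQ: "\<And>Q. Q \<subseteq> D \<Longrightarrow> disj_ends Q \<Longrightarrow> card Q < k"
    and noS: "\<And>u. card {e \<in> D. u \<in> ends e} \<le> m" by (auto simp: not_le not_less)
  let ?F = "{Q. Q \<subseteq> D \<and> disj_ends Q}"
  have fin: "finite (card ` ?F)" using D by simp
  moreover have "{} \<in> ?F" by (simp add: disj_ends_def)
  ultimately have "Max (card ` ?F) \<in> card ` ?F" by (intro Max_in) auto
  then obtain Q where Q: "Q \<subseteq> D" "disj_ends Q" "Max (card ` ?F) = card Q" by auto
  have finQ: "finite Q" using Q(1) D finite_subset by blast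
  let ?V = "\<Union> (ends ` Q)"
  have finV: "finite ?V" using finQ by (auto simp: ends_def)
  have hit: "\<exists>v\<in>?V. v \<in> ends e" if "e \<in> D" for e
  proof (rule ccontr)
    assume no: "\<not> ?thesis"
    then have "e \<notin> Q" by (auto simp: ends_def)
    have "insert e Q \<in> ?F" using Q that no by (auto simp: disj_ends_insert)
    then have "card (insert e Q) \<le> Max (card ` ?F)" by (intro Max_ge[OF fin] imageI)
    then have "card (insert e Q) \<le> card Q" using Q(3) by simp
    then show False using finQ \<open>e \<notin> Q\<close> by simp
  qed
  have "card D \<le> card (\<Union>v\<in>?V. {e \<in> D. v \<in> ends e})"
  proof (rule card_mono)
    show "finite (\<Union>v\<in>?V. {e \<in> D. v \<in> ends e})"
      using D(1) by (rule finite_subset[rotated]) blast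
    show "D \<subseteq> (\<Union>v\<in>?V. {e \<in> D. v \<in> ends e})" using hit by blast
  qed
  also have "\<dots> \<le> (\<Sum>v\<in>?V. card {e \<in> D. v \<in> ends e})" by (rule card_UN_le[OF finV])
  also have "\<dots> \<le> (\<Sum>v\<in>?V. m)" by (intro sum_mono noS)
  also have "\<dots> = card ?V * m" by simp
  also have "\<dots> \<le> 2 * card Q * m" by (intro mult_right_mono card_Union_ends_le[OF finQ]) simp
  also have "\<dots> < 2 * k * m" using noQ[OF Q(1,2)] m by simp
  finally show False using D(2) by simp
qed

text \<open>Apply \<open>matching_or_star\<close> with \<open>m = 2 * k\<close>. A matching of
  \<open>k\<close> edges in \<open>D\<close> weighs at least \<open>t\<close> by itself. Otherwise
  thin \<open>M\<close> to at most \<open>k\<close> edges; their at most \<open>2 * k\<close>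
  endpoints cannot block all edges of the star at \<open>u\<close>. A free star edge replaces the
  edge of the thinned matching at \<open>u\<close>, if any, and is at least as heavy.\<close>

lemma edge_exchange:
  assumes D: "finite D" "4 * k\<^sup>2 \<le> card D" and k: "0 < k" and t: "t \<le> k"
    and finT: "finite T" and disj: "D \<inter> T = {}" and inj: "inj_on ends D"
    and item: "\<forall>e\<in>D \<union> T. 1 \<le> wt e" and dom: "\<forall>x\<in>D. \<forall>y\<in>T. wt y \<le> wt x"
    and M: "M \<subseteq> T" "disj_ends M" "t \<le> sum wt M"
  shows "\<exists>M'\<subseteq>D \<union> T. disj_ends M' \<and> t \<le> sum wt M' \<and> M' \<inter> D \<noteq> {}"
proof -
  have "2 * k * (2 * k) \<le> card D" using D(2) by (simp add: power2_eq_square)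
  then consider Q where "Q \<subseteq> D" "disj_ends Q" "k \<le> card Q"
    | u where "2 * k < card {e \<in> D. u \<in> ends e}"
    using matching_or_star[OF D(1), of k "2 * k"] k by auto
  then show ?thesis
  proof cases
    case 1
    then have "\<forall>e\<in>Q. 1 \<le> wt e" using item by blast
    then have "t \<le> sum wt Q" using card_le_sum_wt[of Q] 1(3) t by simp
    moreover have "Q \<noteq> {}" using 1(3) k by auto
    ultimately show ?thesis using 1 by (intro exI[of _ Q]) auto
  next
    case 2
    obtain M0 where M0: "M0 \<subseteq> M" "card M0 \<le> t" "t \<le> sum wt M0"
      using small_heavy_subset[of M t] M item by auto
    have finM0: "finite M0" using M0(1) M(1) finT by (meson finite_subset)
    have dM0: "disj_ends M0" using M(2) M0(1) by (rule disj_ends_subset)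
    let ?X = "\<Union> (ends ` M0)"
    have finX: "finite ?X" using finM0 by (auto simp: ends_def)
    have "\<exists>f\<in>D. u \<in> ends f \<and> ends f \<inter> ?X \<subseteq> {u}"
    proof (rule ccontr)
      assume no: "\<not> ?thesis"
      \<comment> \<open>A blocked star edge is \<open>{u, x}\<close> with \<open>x\<close> an
        endpoint of \<open>M0\<close>. By injectivity of \<open>ends\<close> there is at most one
        such edge for each \<open>x\<close>.\<close>
      have "ends ` {e \<in> D. u \<in> ends e} \<subseteq> (\<lambda>x. {u, x}) ` ?X"
      proof
        fix g assume "g \<in> ends ` {e \<in> D. u \<in> ends e}"
        then obtain e where e: "g = ends e" "e \<in> D" "u \<in> ends e" by auto
        then have "\<not> ends e \<inter> ?X \<subseteq> {u}" using no by auto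
        then obtain x where x: "x \<in> ends e" "x \<in> ?X" "x \<noteq> u" by auto
        then have "g = {u, x}" using e(1,3) by (auto simp: ends_def)
        then show "g \<in> (\<lambda>x. {u, x}) ` ?X" using x(2) by (rule image_eqI)
      qed
      then have "card (ends ` {e \<in> D. u \<in> ends e}) \<le> card ((\<lambda>x. {u, x}) ` ?X)"
        using finX by (intro card_mono) auto
      also have "\<dots> \<le> card ?X" by (rule card_image_le[OF finX])
      also have "\<dots> \<le> 2 * k" using card_Union_ends_le[OF finM0] M0(2) t by simp
      finally have "card (ends ` {e \<in> D. u \<in> ends e}) \<le> 2 * k" .
      moreover have "card (ends ` {e \<in> D. u \<in> ends e}) = card {e \<in> D. u \<in> ends e}"
        using inj by (intro card_image) (auto intro: inj_on_subset)
      ultimately show False using 2 by simp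
    qed
    then obtain f where f: "f \<in> D" "u \<in> ends f" "ends f \<inter> ?X \<subseteq> {u}" by auto
    define A where "A = {e \<in> M0. u \<notin> ends e}"
    define B where "B = {e \<in> M0. u \<in> ends e}"
    have M0T: "M0 \<subseteq> T" using M0(1) M(1) by simp
    have "f \<notin> A" using f(1) disj M0T by (auto simp: A_def)
    have "disj_ends (insert f A)"
      unfolding disj_ends_insert
    proof (intro conjI ballI impI)
      show "disj_ends A" using dM0 by (rule disj_ends_subset) (auto simp: A_def)
      show "ends f \<inter> ends g = {}" if "g \<in> A" for g using f(3) that by (auto simp: A_def)
    qed
    moreover have "t \<le> sum wt (insert f A)"
    proof -
      have "sum wt M0 = sum wt A + sum wt B"
        using finM0 by (subst sum.union_disjoint[symmetric]) (auto simp: A_def B_def intro: sum.cong)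
      \<comment> \<open>Edges of the matching \<open>M0\<close> that share \<open>u\<close>
        coincide, so the exchange gives up at most one edge.\<close>
      moreover have "sum wt B \<le> wt f"
      proof (cases "B = {}")
        case False
        then obtain g where g: "g \<in> B" by blast
        have "B = {g}" using dM0 g by (auto simp: disj_ends_def B_def)
        then show ?thesis using dom f(1) g M0T by (auto simp: B_def)
      qed simp
      moreover have "finite A" using finM0 by (simp add: A_def)
      ultimately show ?thesis using M0(3) \<open>f \<notin> A\<close> by simp
    qed
    moreover have "insert f A \<subseteq> D \<union> T" using f(1) M0T by (auto simp: A_def)
    ultimately show ?thesis using f(1) by (intro exI[of _ "insert f A"]) auto
  qed
qed

text \<open>The invariant is that of the vertex search, with \<open>D\<close> the edges discarded
  since the last selection. The budget \<open>4 * k^2\<close> is the size at which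
  \<open>edge_exchange\<close> produces a good matching that meets \<open>D\<close>, contradicting
  the invariant.\<close>

lemma srec_edge_complete:
  assumes "distinct ts" "finite D" "D \<inter> set ts = {}" "inj_on ends (D \<union> set ts)"
    and "\<forall>e\<in>D \<union> set ts. 1 \<le> wt e" "\<forall>x\<in>D. \<forall>y\<in>set ts. wt y \<le> wt x"
    and "4 * k\<^sup>2 \<le> card D + d" "4 * k\<^sup>2 \<le> N" "t \<le> k"
    and "\<forall>M\<subseteq>D \<union> set ts. disj_ends M \<and> t \<le> sum wt M \<longrightarrow> M \<inter> D = {}"
    and "\<exists>M\<subseteq>set ts. disj_ends M \<and> t \<le> sum wt M"
  shows "srec False N k d ts es t"
  using assms
proof (induction k d ts es t arbitrary: D rule: srec_induct)
  case (step k d ts es t)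
  note dist = step.prems(1) and finD = step.prems(2)
    and disj = step.prems(3) and inj = step.prems(4) and pos = step.prems(5) and dom = step.prems(6)
    and cardD = step.prems(7) and kN = step.prems(8) and tk = step.prems(9) and none = step.prems(10)
  obtain M where M: "M \<subseteq> set ts" "disj_ends M" "t \<le> sum wt M" using step.prems(11) by auto
  show ?case
  proof (cases "t = 0")
    case False
    then have t: "0 < t" by simp
    then have k: "0 < k" using tk by simp
    have "M \<noteq> {}" using M(3) t by auto
    have d: "0 < d"
    proof (rule ccontr)
      assume "\<not> 0 < d"
      then have "4 * k\<^sup>2 \<le> card D" using cardD by simp
      moreover have "inj_on ends D" using inj by (rule inj_on_subset) simp
      ultimately have "\<exists>M'\<subseteq>D \<union> set ts. disj_ends M' \<and> t \<le> sum wt M' \<and> M' \<inter> D \<noteq> {}"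
        using finD k tk disj pos dom M by (intro edge_exchange[where k = k and M = M]) auto
      then show False using none by auto
    qed
    obtain a b c r where bubble: "bubble ts = (a, b, c) # r"
    proof (cases "bubble ts")
      case Nil
      then have "length (bubble ts) = 0" by simp
      then show ?thesis using \<open>M \<noteq> {}\<close> M(1) by simp
    next
      case (Cons m r)
      then show ?thesis using that by (cases m) auto
    qed
    note set_ts = set_bubble_Cons[OF bubble]
    let ?e = "(a, b, c)" and ?r = "remv a (remv b r)"
    have dist_r: "distinct r" "?e \<notin> set r"
      using dist distinct_bubble_Cons[OF bubble, of "\<lambda>x. x"] by auto
    note set_r = set_remv2_ends[where c = c and a = a and b = b and es = r]
    show ?thesis
    proof (cases "\<exists>M\<subseteq>set ts. ?e \<in> M \<and> disj_ends M \<and> t \<le> sum wt M")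
      case True
      then obtain M where M: "M \<subseteq> set ts" "?e \<in> M" "disj_ends M" "t \<le> sum wt M" by auto
      have finM: "finite M" using M(1) finite_subset by blast
      have sub: "M - {?e} \<subseteq> set ?r"
      proof
        fix f assume f: "f \<in> M - {?e}"
        then have "ends ?e \<inter> ends f = {}" using M(2,3) unfolding disj_ends_def by blast
        then show "f \<in> set ?r" using f M(1) set_ts unfolding set_r by blast
      qed
      have "sum wt M = c + sum wt (M - {?e})"
        using finM M(2) by (simp add: sum.remove wt_def)
      then have w: "t - c \<le> sum wt (M - {?e})" using M(4) by simp
      \<comment> \<open>Positive weights preserve \<open>t \<le> k\<close>: a selection lowers
        \<open>k\<close> by 1 and a positive target by at least 1.\<close>
      have "1 \<le> c" using pos set_ts by (auto simp: wt_def)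
      have "(k - 1)\<^sup>2 \<le> k\<^sup>2" by (intro power_mono) auto
      then have "4 * (k - 1)\<^sup>2 \<le> N" using kN by linarith
      have "srec False N (k - 1) N ?r (remv a (remv b es)) (t - c)"
      proof (rule step.IH(1)[OF k, where D = "{}"])
        show "distinct ?r" using dist_r(1) distinct_remv by blast
        show "inj_on ends ({} \<union> set ?r)"
          using inj by (rule inj_on_subset) (use set_ts set_r in auto)
        show "\<forall>e\<in>{} \<union> set ?r. 1 \<le> wt e" using pos set_ts set_r by auto
        show "t - c \<le> k - 1" using tk \<open>1 \<le> c\<close> by simp
        show "\<exists>M\<subseteq>set ?r. disj_ends M \<and> t - c \<le> sum wt M"
          using sub w M(3) by (intro exI[of _ "M - {?e}"]) (auto intro: disj_ends_subset)
      qed (use \<open>4 * (k - 1)\<^sup>2 \<le> N\<close> in auto)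
      then show ?thesis using srec_bubble_Cons[OF bubble t k d] by simp
    next
      case False
      have "?e \<notin> D" using disj set_ts by auto
      have eq: "insert ?e D \<union> set r = D \<union> set ts" using set_ts by auto
      have "srec False N k (d - 1) r es t"
      proof (rule step.IH(2)[OF d, where D = "insert ?e D"], unfold eq)
        show "\<forall>x\<in>insert ?e D. \<forall>y\<in>set r. wt y \<le> wt x"
          using bubble_max[OF bubble] dom set_ts by (auto simp: wt_def)
        show "4 * k\<^sup>2 \<le> card (insert ?e D) + (d - 1)"
          using cardD finD d \<open>?e \<notin> D\<close> by simp
        show "\<forall>M\<subseteq>D \<union> set ts. disj_ends M \<and> t \<le> sum wt M \<longrightarrow> M \<inter> insert ?e D = {}"
        proof (intro allI impI)
          fix M assume M: "M \<subseteq> D \<union> set ts" "disj_ends M \<and> t \<le> sum wt M"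
          then have "M \<inter> D = {}" using none by auto
          moreover from this have "M \<subseteq> set ts" using M(1) by blast
          then have "?e \<notin> M" using False M(2) by auto
          ultimately show "M \<inter> insert ?e D = {}" by simp
        qed
        have "?e \<notin> M" using False M by auto
        then have "M \<subseteq> set r" using M(1) set_ts by auto
        then show "\<exists>M\<subseteq>set r. disj_ends M \<and> t \<le> sum wt M" using M by (intro exI[of _ M]) simp
        show "insert ?e D \<inter> set r = {}" using disj set_ts dist_r by auto
      qed (use dist_r finD kN inj pos tk in auto)
      then show ?thesis using srec_bubble_Cons[OF bubble t k d] by simp
    qed
  qed simp
qed

section \<open>The two searches decide the instance\<close>

lemma cov_eq_sum: "distinct es \<Longrightarrow> cov S es = sum wt {e \<in> set es. ends e \<inter> S \<noteq> {}}"
proof (induction S es rule: cov.induct)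
  case (2 S a b c es)
  have "{e \<in> set ((a, b, c) # es). ends e \<inter> S \<noteq> {}} =
    (if a \<in> S \<or> b \<in> S then insert (a, b, c) {e \<in> set es. ends e \<inter> S \<noteq> {}}
     else {e \<in> set es. ends e \<inter> S \<noteq> {}})"
    by (auto simp: ends_def)
  then show ?case using 2 by (simp add: wt_def)
qed simp

text \<open>At the root nothing has been discarded, so both completeness lemmas apply with
  \<open>D = {}\<close>. Injectivity of \<open>ends\<close> on the edge list transfers matchings
  between items and edges.\<close>

lemma main_correct:
  assumes I: "mepvcb_instance I" and le: "k3 I \<le> k1 I"
    and vs: "distinct vs" "set vs = verts I"
    and es: "distinct (map ends es)" "ends ` set es = edges I" "\<forall>e\<in>set es. wt e = weight I (ends e)"
    and N: "N = 2 ^ (2 * k1 I + 2)"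
  shows "mepvcb_yes I \<longleftrightarrow>
    srec True N (k1 I) N (rekey es (vertex_items vs)) es (k2 I) \<and> srec False N (k1 I) N es [] (k3 I)"
proof -
  let ?E = "edges I"
  have inj: "inj_on ends (set es)" and dist: "distinct es" using es(1) by (auto simp: distinct_map)
  have sum_ends: "sum (weight I) (ends ` M) = sum wt M" if "M \<subseteq> set es" for M
  proof -
    have "sum (weight I) (ends ` M) = sum (weight I \<circ> ends) M"
      using inj that by (intro sum.reindex) (rule inj_on_subset)
    also have "\<dots> = sum wt M" using that es(3) by (intro sum.cong) auto
    finally show ?thesis .
  qed
  \<comment> \<open>\<open>N\<close> equals \<open>4 * (2 ^ k1 I)^2\<close>, hence exceeds both
    budgets; as a power of two it is computed by doubling in a language without
    multiplication.\<close>
  have "k1 I < 2 ^ k1 I" by (rule less_exp)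
  then have "(k1 I)\<^sup>2 \<le> (2 ^ k1 I)\<^sup>2" by (intro power_mono) auto
  then have N4: "4 * (k1 I)\<^sup>2 \<le> N" by (simp add: N power_add power_mult power2_eq_square
        flip: power_mult_distrib)
  have N2: "2 * k1 I \<le> N" using less_exp[of "2 * k1 I + 2"] unfolding N by linarith
  obtain A B where AB: "A \<union> B = verts I" "A \<inter> B = {}" "\<forall>e\<in>?E. \<exists>a\<in>A. \<exists>b\<in>B. e = {a, b}"
    using I by (auto simp: mepvcb_instance_def bipartite_def)
  have bip: "\<forall>(a, b, c)\<in>set es. (a \<in> A) \<noteq> (b \<in> A)"
  proof clarify
    fix a b c assume e: "(a, b, c) \<in> set es" and eq: "(a \<in> A) = (b \<in> A)"
    then have "{a, b} \<in> ?E" using es(2) by (force simp: ends_def)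
    then obtain a' b' where "a' \<in> A" "b' \<in> B" "{a, b} = {a', b'}" using AB(3) by blast
    moreover have "b' \<notin> A" using AB(2) \<open>b' \<in> B\<close> by blast
    ultimately show False using eq by (auto simp: doubleton_eq_iff)
  qed
  have cov: "sum (weight I) (covered_edges ?E S) = cov S es" for S
  proof -
    have "covered_edges ?E S = ends ` {e \<in> set es. ends e \<inter> S \<noteq> {}}"
      unfolding covered_edges_def es(2)[symmetric] by auto
    then show ?thesis using cov_eq_sum[OF dist] sum_ends by simp
  qed
  have fst_TS: "fst ` set (rekey es (vertex_items vs)) = verts I"
    using vs(2) by (simp add: image_image)
  have "map fst (vertex_items vs) = vs" by (induction vs) auto
  then have dist_TS: "distinct (map fst (rekey es (vertex_items vs)))" using vs(1) by simp
  have TS: "\<forall>(a, b, c)\<in>set (rekey es (vertex_items vs)). a = b \<and> c = deg a es"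
    by (auto simp: set_rekey)
  have vertex: "srec True N (k1 I) N (rekey es (vertex_items vs)) es (k2 I) \<longleftrightarrow>
    (\<exists>S\<subseteq>verts I. card S \<le> k1 I \<and> k2 I \<le> sum (weight I) (covered_edges ?E S))"
    unfolding cov
  proof
    assume "srec True N (k1 I) N (rekey es (vertex_items vs)) es (k2 I)"
    from srec_vertex_sound[OF this TS]
    show "\<exists>S\<subseteq>verts I. card S \<le> k1 I \<and> k2 I \<le> cov S es" unfolding fst_TS .
  next
    assume "\<exists>S\<subseteq>verts I. card S \<le> k1 I \<and> k2 I \<le> cov S es"
    then show "srec True N (k1 I) N (rekey es (vertex_items vs)) es (k2 I)"
      by (intro srec_vertex_complete[where D = "{}", OF bip TS dist_TS], unfold fst_TS)
        (use N2 in auto)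
  qed
  have pos: "\<forall>e\<in>set es. 1 \<le> wt e"
    using I es(2,3) by (auto simp: mepvcb_instance_def Suc_le_eq)
  have "(\<exists>M\<subseteq>set es. disj_ends M \<and> k3 I \<le> sum wt M) \<longleftrightarrow>
    (\<exists>M\<subseteq>?E. matching M \<and> k3 I \<le> sum (weight I) M)"
  proof
    assume "\<exists>M\<subseteq>set es. disj_ends M \<and> k3 I \<le> sum wt M"
    then obtain M where M: "M \<subseteq> set es" "disj_ends M" "k3 I \<le> sum wt M" by auto
    have "matching (ends ` M)"
      unfolding matching_def
    proof (intro ballI impI)
      fix g h assume "g \<in> ends ` M" "h \<in> ends ` M" "g \<noteq> h"
      then show "g \<inter> h = {}" using M(2) unfolding disj_ends_def by (metis imageE)
    qed
    moreover have "ends ` M \<subseteq> ?E" using M(1) es(2) by blast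
    ultimately show "\<exists>M\<subseteq>?E. matching M \<and> k3 I \<le> sum (weight I) M"
      using M(3) sum_ends[OF M(1)] by (intro exI[of _ "ends ` M"]) simp
  next
    assume "\<exists>M\<subseteq>?E. matching M \<and> k3 I \<le> sum (weight I) M"
    then obtain M where M: "M \<subseteq> ends ` set es" "matching M" "k3 I \<le> sum (weight I) M"
      unfolding es(2) by auto
    from M(1) obtain M' where M': "M' \<subseteq> set es" "M = ends ` M'" by (rule subset_imageE)
    have "disj_ends M'"
      unfolding disj_ends_def
    proof (intro ballI impI)
      fix e f assume "e \<in> M'" "f \<in> M'" "e \<noteq> f"
      then have "ends e \<noteq> ends f" using inj M'(1) by (meson inj_onD subsetD)
      then show "ends e \<inter> ends f = {}"
        using M(2) \<open>e \<in> M'\<close> \<open>f \<in> M'\<close> unfolding matching_def M'(2) by blast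
    qed
    then show "\<exists>M\<subseteq>set es. disj_ends M \<and> k3 I \<le> sum wt M"
      using M' M(3) sum_ends[OF M'(1)] by (intro exI[of _ M']) simp
  qed
  moreover have "srec False N (k1 I) N es [] (k3 I) \<longleftrightarrow>
    (\<exists>M\<subseteq>set es. disj_ends M \<and> k3 I \<le> sum wt M)"
  proof
    assume "\<exists>M\<subseteq>set es. disj_ends M \<and> k3 I \<le> sum wt M"
    then show "srec False N (k1 I) N es [] (k3 I)"
      using dist inj pos N4 le by (intro srec_edge_complete[where D = "{}"]) auto
  qed (rule srec_edge_sound)
  ultimately show ?thesis using mepvcb_yes_iff[OF I le] vertex by simp
qed

section \<open>Evaluation with time bounds\<close>

text \<open>The rules below stop at this predicate, so rewriting with them executes one body
  symbolically and leaves its calls, recursive ones included, to separate lemmas.\<close>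

definition call :: "program \<Rightarrow> nat \<Rightarrow> val \<Rightarrow> val \<Rightarrow> nat \<Rightarrow> bool" where
  "call p f u v t \<longleftrightarrow> f < length p \<and> eval p [u] (p ! f) v t"

lemma eval_EVar: "eval p \<rho> (EVar i) v t \<longleftrightarrow> i < length \<rho> \<and> v = \<rho> ! i \<and> t = 1"
  by (auto elim: eval.cases intro: eval.intros[simplified])

lemma eval_EConst: "eval p \<rho> (EConst n) v t \<longleftrightarrow> v = Num n \<and> t = 1"
  by (auto elim: eval.cases intro: eval.intros[simplified])

lemma eval_EAdd: "eval p \<rho> (EAdd a b) v t \<longleftrightarrow>
    (\<exists>m s. eval p \<rho> a (Num m) s \<and> (\<exists>n r. eval p \<rho> b (Num n) r \<and>
      v = Num (m + n) \<and> t = s + r + floorlog 2 m + floorlog 2 n + 1))"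
  by (rule iffI, erule eval.cases) (auto intro: eval.intros[simplified])

lemma eval_ESub: "eval p \<rho> (ESub a b) v t \<longleftrightarrow>
    (\<exists>m s. eval p \<rho> a (Num m) s \<and> (\<exists>n r. eval p \<rho> b (Num n) r \<and>
      v = Num (m - n) \<and> t = s + r + floorlog 2 m + floorlog 2 n + 1))"
  by (rule iffI, erule eval.cases) (auto intro: eval.intros[simplified])

lemma eval_ENode: "eval p \<rho> (ENode a b) v t \<longleftrightarrow>
    (\<exists>x s. eval p \<rho> a x s \<and> (\<exists>y r. eval p \<rho> b y r \<and> v = Node x y \<and> t = s + r + 1))"
  by (rule iffI, erule eval.cases) (auto intro: eval.intros[simplified])

lemma eval_EFst: "eval p \<rho> (EFst a) v t \<longleftrightarrow> (\<exists>y s. eval p \<rho> a (Node v y) s \<and> t = s + 1)"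
  by (rule iffI, erule eval.cases) (auto intro: eval.Fst[simplified])

lemma eval_ESnd: "eval p \<rho> (ESnd a) v t \<longleftrightarrow> (\<exists>y s. eval p \<rho> a (Node y v) s \<and> t = s + 1)"
  by (rule iffI, erule eval.cases) (auto intro: eval.Snd[simplified])

lemma eval_EIf: "eval p \<rho> (EIf c a b) v t \<longleftrightarrow>
    (\<exists>u s. eval p \<rho> c u s \<and>
      (\<exists>r. (if u = Num 0 then eval p \<rho> b v r else eval p \<rho> a v r) \<and> t = s + r + 1))"
  by (rule iffI, erule eval.cases)
    (auto intro: eval.If_nonzero[simplified] eval.If_zero[simplified] split: if_splits)

lemma eval_ELet: "eval p \<rho> (ELet a b) v t \<longleftrightarrow>
    (\<exists>u s. eval p \<rho> a u s \<and> (\<exists>r. eval p (u # \<rho>) b v r \<and> t = s + r + 1))"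
  by (rule iffI, erule eval.cases) (auto intro: eval.Let[simplified])

lemma eval_ECall: "eval p \<rho> (ECall f a) v t \<longleftrightarrow>
    (\<exists>u s. eval p \<rho> a u s \<and> (\<exists>r. call p f u v r \<and> t = s + r + 1))"
  unfolding call_def by (rule iffI, erule eval.cases) (auto intro: eval.Call[simplified])

lemmas eval_iffs = eval_EVar eval_EConst eval_EAdd eval_ESub eval_ENode eval_EFst eval_ESnd
  eval_EIf eval_ELet eval_ECall

lemma call_determ: "call p f u v t \<Longrightarrow> call p f u v' t' \<longleftrightarrow> v' = v \<and> t' = t"
  unfolding call_def using eval_deterministic by blast

definition calls :: "program \<Rightarrow> nat \<Rightarrow> val \<Rightarrow> val \<Rightarrow> nat \<Rightarrow> bool" where
  "calls p f u v T \<longleftrightarrow> (\<exists>t\<le>T. call p f u v t)"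

text \<open>By determinism a known call becomes a rewrite rule for its value and time, the form that
  symbolic execution can use.\<close>

lemma callsE:
  assumes "calls p f u v T"
  obtains t where "t \<le> T" "\<And>v' t'. call p f u v' t' \<longleftrightarrow> v' = v \<and> t' = t"
  using assms call_determ unfolding calls_def by blast

lemma calls_mono: "calls p f u v T \<Longrightarrow> T \<le> T' \<Longrightarrow> calls p f u v T'"
  unfolding calls_def using le_trans by blast

section \<open>The program\<close>

text \<open>The recursive call goes to index 1, so the body works in any program that has it there;
  \<open>computable_double_exp\<close> relies on this. The \<open>ELet\<close> avoids a second
  recursive call.\<close>

definition pow2_body :: expr where
  "pow2_body = EIf (EVar 0)
     (ELet (ECall 1 (ESub (EVar 0) (EConst 1))) (EAdd (EVar 0) (EVar 0)))
     (EConst 1)"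

definition key :: "expr \<Rightarrow> expr" where
  "key e = EFst (ESnd (ESnd e))"

text \<open>Subtraction is truncated, so the sum is zero exactly for equal operands.\<close>

definition neq :: "expr \<Rightarrow> expr \<Rightarrow> expr" where
  "neq a b = EAdd (ESub a b) (ESub b a)"

definition bubble_body :: expr where
  "bubble_body = EIf (EVar 0)
     (ELet (ECall 2 (ESnd (EVar 0)))
       (EIf (EVar 0)
         (EIf (ESub (key (EFst (EVar 0))) (key (EFst (EVar 1))))
           (ENode (EFst (EVar 0)) (ENode (EFst (EVar 1)) (ESnd (EVar 0))))
           (ENode (EFst (EVar 1)) (EVar 0)))
         (ENode (EFst (EVar 1)) (EConst 0))))
     (EConst 0)"

text \<open>The argument pairs a vertex with a list. Below both \<open>ELet\<close>s,
  \<open>EVar 0\<close> is the recursive result, \<open>EVar 1\<close> the head item and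
  \<open>EVar 2\<close> the argument; \<open>deg_body\<close> has the same layout.\<close>

definition remv_body :: expr where
  "remv_body = EIf (ESnd (EVar 0))
     (ELet (EFst (ESnd (EVar 0)))
       (ELet (ECall 3 (ENode (EFst (EVar 1)) (ESnd (ESnd (EVar 1)))))
         (EIf (neq (EFst (EVar 1)) (EFst (EVar 2)))
           (EIf (neq (EFst (ESnd (EVar 1))) (EFst (EVar 2)))
             (ENode (EVar 1) (EVar 0))
             (EVar 0))
           (EVar 0))))
     (EConst 0)"

definition deg_body :: expr where
  "deg_body = EIf (ESnd (EVar 0))
     (ELet (EFst (ESnd (EVar 0)))
       (ELet (ECall 4 (ENode (EFst (EVar 1)) (ESnd (ESnd (EVar 1)))))
         (EIf (neq (EFst (EVar 1)) (EFst (EVar 2)))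
           (EIf (neq (EFst (ESnd (EVar 1))) (EFst (EVar 2)))
             (EVar 0)
             (EAdd (key (EVar 1)) (EVar 0)))
           (EAdd (key (EVar 1)) (EVar 0)))))
     (EConst 0)"

definition rekey_body :: expr where
  "rekey_body = EIf (ESnd (EVar 0))
     (ELet (EFst (EFst (ESnd (EVar 0))))
       (ENode
         (ENode (EVar 0) (ENode (EVar 0)
           (ENode (ECall 4 (ENode (EVar 0) (EFst (EVar 1)))) (EConst 0))))
         (ECall 5 (ENode (EFst (EVar 1)) (ESnd (ESnd (EVar 1)))))))
     (EConst 0)"

definition vertex_items_body :: expr where
  "vertex_items_body = EIf (EVar 0)
     (ENode (ENode (EFst (EVar 0)) (ENode (EFst (EVar 0)) (ENode (EConst 0) (EConst 0))))
       (ECall 6 (ESnd (EVar 0))))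
     (EConst 0)"

fun arg :: "nat \<Rightarrow> expr \<Rightarrow> expr" where
  "arg 0 e = EFst e"
| "arg (Suc n) e = arg n (ESnd e)"

definition remv2 :: "expr \<Rightarrow> expr \<Rightarrow> expr" where
  "remv2 e l = ECall 3 (ENode (EFst e) (ECall 3 (ENode (EFst (ESnd e)) l)))"

text \<open>The argument is the list of \<open>vm\<close> (as a number), items, edges, \<open>k\<close>, \<open>d\<close>, \<open>N\<close>, \<open>t\<close>.\<close>

definition srec_body :: expr where
  "srec_body = EIf (arg 6 (EVar 0))
     (EIf (arg 3 (EVar 0)) (EIf (arg 4 (EVar 0)) (EIf (arg 1 (EVar 0))
       (ELet (ECall 2 (arg 1 (EVar 0)))
       (ELet (remv2 (EFst (EVar 0)) (arg 2 (EVar 1)))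
         (EIf (ECall 7
             (ENode (arg 0 (EVar 2))
             (ENode (EIf (arg 0 (EVar 2))
                      (ECall 5 (ENode (EVar 0) (ESnd (EVar 1))))
                      (remv2 (EFst (EVar 1)) (ESnd (EVar 1))))
             (ENode (EVar 0)
             (ENode (ESub (arg 3 (EVar 2)) (EConst 1))
             (ENode (arg 5 (EVar 2))
             (ENode (arg 5 (EVar 2))
             (ENode (ESub (arg 6 (EVar 2)) (key (EFst (EVar 1)))) (EConst 0)))))))))
           (EConst 1)
           (ECall 7
             (ENode (arg 0 (EVar 2))
             (ENode (ESnd (EVar 1))
             (ENode (arg 2 (EVar 2))
             (ENode (arg 3 (EVar 2))
             (ENode (ESub (arg 4 (EVar 2)) (EConst 1))
             (ENode (arg 5 (EVar 2))
             (ENode (arg 6 (EVar 2)) (EConst 0))))))))))))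
       (EConst 0)) (EConst 0)) (EConst 0))
     (EConst 1)"

definition main_body :: expr where
  "main_body =
    ELet (ECall 1 (EAdd (EAdd (arg 2 (EVar 0)) (arg 2 (EVar 0))) (EConst 2)))
    (EIf (ECall 7
        (ENode (EConst 1)
        (ENode (ECall 5 (ENode (arg 1 (EVar 1)) (ECall 6 (arg 0 (EVar 1)))))
        (ENode (arg 1 (EVar 1))
        (ENode (arg 2 (EVar 1))
        (ENode (EVar 0)
        (ENode (EVar 0)
        (ENode (arg 3 (EVar 1)) (EConst 0)))))))))
      (ECall 7
        (ENode (EConst 0)
        (ENode (arg 1 (EVar 1))
        (ENode (EConst 0)
        (ENode (arg 2 (EVar 1))
        (ENode (EVar 0)
        (ENode (EVar 0)
        (ENode (arg 4 (EVar 1)) (EConst 0)))))))))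
      (EConst 0))"

definition prog :: program where
  "prog = [main_body, pow2_body, bubble_body, remv_body, deg_body,
      rekey_body, vertex_items_body, srec_body]"

section \<open>Running times of the list routines\<close>

fun enc_item :: "item \<Rightarrow> val" where
  "enc_item (a, b, c) = Node (Num a) (Node (Num b) (Node (Num c) (Num 0)))"

abbreviation enc_items :: "item list \<Rightarrow> val" where
  "enc_items ts \<equiv> val_list (map enc_item ts)"

fun items_le :: "nat \<Rightarrow> item list \<Rightarrow> bool" where
  "items_le W [] \<longleftrightarrow> True"
| "items_le W ((a, b, c) # ts) \<longleftrightarrow> a \<le> W \<and> b \<le> W \<and> c \<le> W \<and> items_le W ts"

text \<open>A generous allowance for one activation of a list routine, calls excluded: a constant
  number of steps and of arithmetic operations on numbers up to \<open>W\<close>.\<close>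

definition unit_time :: "nat \<Rightarrow> nat" where
  "unit_time W = 100 + 20 * floorlog 2 W"

lemma floorlog_le: "m \<le> W \<Longrightarrow> floorlog 2 m \<le> floorlog 2 W"
  by (rule floorlog_mono)

lemma call_prog:
  "call prog 0 u v t \<longleftrightarrow> eval prog [u] main_body v t"
  "call prog (Suc 0) u v t \<longleftrightarrow> eval prog [u] pow2_body v t"
  "call prog 2 u v t \<longleftrightarrow> eval prog [u] bubble_body v t"
  "call prog 3 u v t \<longleftrightarrow> eval prog [u] remv_body v t"
  "call prog 4 u v t \<longleftrightarrow> eval prog [u] deg_body v t"
  "call prog 5 u v t \<longleftrightarrow> eval prog [u] rekey_body v t"
  "call prog 6 u v t \<longleftrightarrow> eval prog [u] vertex_items_body v t"
  "call prog 7 u v t \<longleftrightarrow> eval prog [u] srec_body v t"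
  unfolding call_def prog_def by simp_all

lemma calls_pow2:
  assumes "length p > 1" "p ! 1 = pow2_body" "2 ^ n \<le> W"
  shows "calls p 1 (Num n) (Num (2 ^ n)) ((n + 1) * unit_time W)"
  using assms(3)
proof (induction n)
  case 0
  have c: "call p 1 u v t \<longleftrightarrow> eval p [u] pow2_body v t" for u v t
    using assms by (simp add: call_def)
  show ?case
    unfolding calls_def c pow2_body_def by (simp add: eval_iffs unit_time_def)
next
  case (Suc n)
  have c: "call p 1 u v t \<longleftrightarrow> eval p [u] pow2_body v t" for u v t
    using assms by (simp add: call_def)
  obtain t where t: "t \<le> (n + 1) * unit_time W"
    and [simp]: "\<And>v' t'. call p (Suc 0) (Num n) v' t' \<longleftrightarrow> v' = Num (2 ^ n) \<and> t' = t"
    using Suc by (auto elim!: callsE)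
  have "Suc n < 2 ^ Suc n" by (rule less_exp)
  then have "floorlog 2 (Suc n) \<le> floorlog 2 W" "floorlog 2 (2 ^ n) \<le> floorlog 2 W"
    "floorlog 2 (Suc 0) \<le> floorlog 2 W"
    using Suc.prems by (auto intro!: floorlog_le)
  then show ?case using t
    unfolding calls_def c pow2_body_def by (simp add: eval_iffs unit_time_def)
qed

lemma items_le_iff: "items_le W ts \<longleftrightarrow> (\<forall>(a, b, c)\<in>set ts. a \<le> W \<and> b \<le> W \<and> c \<le> W)"
  by (induction W ts rule: items_le.induct) auto

lemma calls_bubble:
  "items_le W ts \<Longrightarrow> calls prog 2 (enc_items ts) (enc_items (bubble ts))
      ((length ts + 1) * unit_time W)"
proof (induction ts)
  case Nil
  show ?case unfolding calls_def call_prog bubble_body_def by (simp add: eval_iffs unit_time_def)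
next
  case (Cons x ts)
  obtain a b c where x: "x = (a, b, c)" by (cases x)
  obtain t where t: "t \<le> (length ts + 1) * unit_time W"
    and [simp]: "\<And>v' t'. call prog 2 (enc_items ts) v' t' \<longleftrightarrow> v' = enc_items (bubble ts) \<and> t' = t"
    using Cons by (auto elim!: callsE simp: x)
  show ?case
  proof (cases "bubble ts")
    case Nil
    \<comment> \<open>The unfolding rule is instantiated to a \<open>Node\<close>, so it opens only
      the outer call and leaves the one on the tail to the induction hypothesis.\<close>
    then show ?thesis using t unfolding calls_def x
      by (simp add: call_prog(3)[of "Node _ _"] bubble_body_def key_def eval_iffs unit_time_def)
  next
    case (Cons m r)
    obtain a' b' c' where m: "m = (a', b', c')" by (cases m)
    have "items_le W (bubble ts)" using Cons.prems by (simp add: items_le_iff)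
    then have "floorlog 2 c \<le> floorlog 2 W" "floorlog 2 c' \<le> floorlog 2 W"
      using Cons.prems by (auto intro!: floorlog_le simp: x m Cons)
    then show ?thesis using t unfolding calls_def x

          by (auto simp: call_prog(3)[of "Node _ _"] bubble_body_def key_def eval_iffs unit_time_def Cons m)
  qed
qed

lemma Num_neq: "Num ((a - b) + (b - a)) = Num 0 \<longleftrightarrow> a = b" by auto

lemma calls_remv:
  "items_le W ts \<Longrightarrow> x \<le> W \<Longrightarrow>
    calls prog 3 (Node (Num x) (enc_items ts)) (enc_items (remv x ts))
        ((length ts + 1) * unit_time W)"
proof (induction ts)
  case Nil
  show ?case unfolding calls_def call_prog remv_body_def by (simp add: eval_iffs unit_time_def)
next
  case (Cons y ts)
  obtain a b c where y: "y = (a, b, c)" by (cases y)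
  obtain t where t: "t \<le> (length ts + 1) * unit_time W"
    and [simp]: "\<And>v' t'. call prog 3 (Node (Num x) (enc_items ts)) v' t' \<longleftrightarrow>
        v' = enc_items (remv x ts) \<and> t' = t"
    using Cons by (auto elim!: callsE simp: y)
  have "floorlog 2 a \<le> floorlog 2 W" "floorlog 2 b \<le> floorlog 2 W" "floorlog 2 x \<le> floorlog 2 W"
    "floorlog 2 (a - x) \<le> floorlog 2 W" "floorlog 2 (x - a) \<le> floorlog 2 W"
    "floorlog 2 (b - x) \<le> floorlog 2 W" "floorlog 2 (x - b) \<le> floorlog 2 W"
    using Cons.prems by (auto intro!: floorlog_le simp: y)
  then show ?case using t unfolding calls_def y
    by (cases "a = x"; cases "b = x")
      (simp_all add: call_prog(4)[of "Node _ (Node _ _)"]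
          remv_body_def neq_def Num_neq eval_iffs unit_time_def)
qed

text \<open>The total weight bounds every degree, so \<open>sumw es \<le> W\<close> keeps all
  partial sums and recomputed keys below \<open>W\<close>.\<close>

fun sumw :: "item list \<Rightarrow> nat" where
  "sumw [] = 0"
| "sumw ((a, b, c) # es) = c + sumw es"

lemma deg_le_sumw: "deg x es \<le> sumw es"
  by (induction x es rule: deg.induct) auto

lemma calls_deg:
  "items_le W es \<Longrightarrow> sumw es \<le> W \<Longrightarrow> x \<le> W \<Longrightarrow>
    calls prog 4 (Node (Num x) (enc_items es)) (Num (deg x es)) ((length es + 1) * unit_time W)"
proof (induction es)
  case Nil
  show ?case unfolding calls_def call_prog deg_body_def by (simp add: eval_iffs unit_time_def)
next
  case (Cons y es)
  obtain a b c where y: "y = (a, b, c)" by (cases y)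
  obtain t where t: "t \<le> (length es + 1) * unit_time W"
    and [simp]: "\<And>v' t'. call prog 4 (Node (Num x) (enc_items es)) v' t' \<longleftrightarrow>
        v' = Num (deg x es) \<and> t' = t"
    using Cons by (auto elim!: callsE simp: y)
  have "floorlog 2 a \<le> floorlog 2 W" "floorlog 2 b \<le> floorlog 2 W" "floorlog 2 x \<le> floorlog 2 W"
    "floorlog 2 c \<le> floorlog 2 W" "floorlog 2 (deg x es) \<le> floorlog 2 W"
    "floorlog 2 (a - x) \<le> floorlog 2 W" "floorlog 2 (x - a) \<le> floorlog 2 W"
    "floorlog 2 (b - x) \<le> floorlog 2 W" "floorlog 2 (x - b) \<le> floorlog 2 W"
    using Cons.prems deg_le_sumw[of x es] by (auto intro!: floorlog_le simp: y)
  then show ?case using t unfolding calls_def y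
    by (cases "a = x"; cases "b = x")
      (simp_all add: call_prog(5)[of "Node _ (Node _ _)"]
          deg_body_def neq_def key_def Num_neq eval_iffs
        unit_time_def)
qed

text \<open>Each item pays \<open>length es + 1\<close> units for its degree and one more for the
  body itself.\<close>

lemma calls_rekey:
  "items_le W es \<Longrightarrow> sumw es \<le> W \<Longrightarrow> items_le W ts \<Longrightarrow>
    calls prog 5 (Node (enc_items es) (enc_items ts)) (enc_items (rekey es ts))
      ((length ts + 1) * ((length es + 2) * unit_time W))"
proof (induction ts)
  case Nil
  show ?case unfolding calls_def call_prog rekey_body_def
      by (simp add: eval_iffs unit_time_def rekey_def)
next
  case (Cons y ts)
  obtain a b c where y: "y = (a, b, c)" by (cases y)
  obtain t where t: "t \<le> (length ts + 1) * ((length es + 2) * unit_time W)"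
    and [simp]: "\<And>v' t'. call prog 5 (Node (enc_items es) (enc_items ts)) v' t' \<longleftrightarrow>
        v' = enc_items (rekey es ts) \<and> t' = t"
    using Cons by (auto elim!: callsE simp: y)
  obtain s where s: "s \<le> (length es + 1) * unit_time W"
    and [simp]: "\<And>v' t'. call prog 4 (Node (Num a) (enc_items es)) v' t' \<longleftrightarrow>
        v' = Num (deg a es) \<and> t' = s"
    using calls_deg[of W es a] Cons.prems by (auto elim!: callsE simp: y)
  have "27 + t + s \<le> (length (y # ts) + 1) * ((length es + 2) * unit_time W)"
    using s t by (simp add: unit_time_def)
  then show ?case unfolding calls_def y
    by (simp add: call_prog(6)[of "Node _ (Node _ _)"] rekey_body_def eval_iffs)
     (simp add: rekey_def)
qed

lemma calls_vertex_items:
  "calls prog 6 (val_list (map Num vs)) (enc_items (vertex_items vs))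
      ((length vs + 1) * unit_time W)"
proof (induction vs)
  case Nil
  show ?case unfolding calls_def call_prog vertex_items_body_def
      by (simp add: eval_iffs unit_time_def)
next
  case (Cons y ts)
  obtain t where t: "t \<le> (length ts + 1) * unit_time W"
    and [simp]: "\<And>v' t'. call prog 6 (val_list (map Num ts)) v' t' \<longleftrightarrow>
        v' = enc_items (vertex_items ts) \<and> t' = t"
    using Cons by (auto elim!: callsE)
  then show ?case using t unfolding calls_def
    by (simp add: call_prog(7)[of "Node _ _"] vertex_items_body_def eval_iffs unit_time_def)
qed

lemma arg_numeral:
  "arg 1 e = EFst (ESnd e)"
  "arg (Suc 0) e = EFst (ESnd e)"
  "arg 2 e = EFst (ESnd (ESnd e))"
  "arg 3 e = EFst (ESnd (ESnd (ESnd e)))"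
  "arg 4 e = EFst (ESnd (ESnd (ESnd (ESnd e))))"
  "arg 5 e = EFst (ESnd (ESnd (ESnd (ESnd (ESnd e)))))"
  "arg 6 e = EFst (ESnd (ESnd (ESnd (ESnd (ESnd (ESnd e))))))"
  by (simp_all add: numeral_eq_Suc)

section \<open>Running time of the search tree\<close>

lemma items_le_subset: "items_le W ts \<Longrightarrow> set ts' \<subseteq> set ts \<Longrightarrow> items_le W ts'"
  unfolding items_le_iff by blast

lemma items_le_remv: "items_le W ts \<Longrightarrow> items_le W (remv x ts)"
  by (erule items_le_subset) (auto simp: set_remv)

lemma length_remv_le: "length (remv x ts) \<le> length ts"
  by (induction x ts rule: remv.induct) auto

lemma sumw_remv_le: "sumw (remv x ts) \<le> sumw ts"
  by (induction x ts rule: remv.induct) auto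

lemma items_le_rekey:
  assumes "items_le W ts" "sumw es \<le> W"
  shows "items_le W (rekey es ts)"
proof -
  have "deg a es \<le> W" for a using deg_le_sumw[of a es] assms(2) by simp
  then show ?thesis using assms(1) by (auto simp: items_le_iff rekey_def)
qed

lemma length_rekey [simp]: "length (rekey es ts) = length ts"
  by (simp add: rekey_def)

definition sargs :: "nat \<Rightarrow> item list \<Rightarrow> item list \<Rightarrow> nat \<Rightarrow> nat \<Rightarrow> nat \<Rightarrow> nat \<Rightarrow> val" where
  "sargs f ts es k d N t =
    val_list [Num f, enc_items ts, enc_items es, Num k, Num d, Num N, Num t]"

text \<open>The allowance for one node of the search tree without its subtrees. The square comes
  from \<open>rekey\<close>, which scans the edge list once per item.\<close>

definition step_time :: "nat \<Rightarrow> nat \<Rightarrow> nat" where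
  "step_time L W = 10 * (L + 2)\<^sup>2 * unit_time W"

lemma val_list_eq_0: "val_list xs = Num 0 \<longleftrightarrow> xs = []"
  by (cases xs) auto

text \<open>Both recursive calls lower \<open>k (N + 1) + d\<close>, so the recursion tree has at most that depth.\<close>

lemma calls_srec:
  assumes "items_le W ts" "items_le W es" "sumw es \<le> W" "length ts \<le> L" "length es \<le> L"
    and "k \<le> W" "d \<le> W" "N \<le> W" "t \<le> W" and f: "f = 0 \<longleftrightarrow> \<not> vm"
  shows "calls prog 7 (sargs f ts es k d N t) (Num (if srec vm N k d ts es t then 1 else 0))
    (step_time L W * (2 ^ (k * (N + 1) + d + 1) - 1))"
  using assms(1-9)
proof (induction k d ts es t rule: srec_induct)
  case (step k d ts es t)
  note le = step.prems
  define P where "P = step_time L W"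
  define X where "X = P * (2 ^ (k * (N + 1) + d + 1) - 1)"
  have X1: "P \<le> X"
  proof -
    have "(2::nat) ^ 1 \<le> 2 ^ (k * (N + 1) + d + 1)" by (intro power_increasing) auto
    then have "1 \<le> (2::nat) ^ (k * (N + 1) + d + 1) - 1" unfolding power_one_right by linarith
    then have "P * 1 \<le> X" unfolding X_def by (rule mult_left_mono) simp
    then show ?thesis by simp
  qed
  have "unit_time W \<le> P" unfolding P_def step_time_def by simp
  then have X2: "100 + 20 * floorlog 2 W \<le> X" using X1 by (simp add: unit_time_def)
  have call: "call prog 7 (sargs f ts es k d N t) v s \<longleftrightarrow>
      eval prog [sargs f ts es k d N t] srec_body v s" for v s
    by (rule call_prog)
  have "calls prog 7 (sargs f ts es k d N t) (Num (if srec vm N k d ts es t then 1 else 0)) X"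
  proof (cases "t = 0 \<or> k = 0 \<or> d = 0 \<or> ts = []")
    case True
    then have "srec vm N k d ts es t \<longleftrightarrow> t = 0" by (subst srec.simps) auto
    then show ?thesis
      unfolding calls_def call srec_body_def using True X2
      by (cases "t = 0"; cases "k = 0"; cases "d = 0")
        (simp_all add: sargs_def eval_iffs arg_numeral)
  next
    case False
    then have pos: "0 < t" "0 < k" "0 < d" "ts \<noteq> []" by auto
    obtain a b c r where bubble: "bubble ts = (a, b, c) # r"
    proof (cases "bubble ts")
      case Nil
      then have "length (bubble ts) = 0" by simp
      then show ?thesis using pos by simp
    next
      case (Cons m r)
      then show ?thesis using that by (cases m) auto
    qed
    define es' where "es' = remv a (remv b es)"
    define ts' where "ts' = (if vm then rekey es' r else remv a (remv b r))"
    have abc: "a \<le> W" "b \<le> W" "c \<le> W" and le_r: "items_le W r"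
      using le(1) set_bubble_Cons[OF bubble] by (auto simp: items_le_iff)
    have len_r: "length r \<le> L" using length_bubble[of ts] bubble le(4) by simp
    have le_es': "items_le W es'" "sumw es' \<le> W" "length es' \<le> L"
      unfolding es'_def
      using le items_le_remv length_remv_le[of a "remv b es"] length_remv_le[of b es]
        sumw_remv_le[of a "remv b es"] sumw_remv_le[of b es] by auto
    have le_ts': "items_le W ts'" "length ts' \<le> L"
      unfolding ts'_def
      using le_r le_es' items_le_remv items_le_rekey len_r length_remv_le[of a "remv b r"]
        length_remv_le[of b r] by auto
    define Y where "Y = (L + 1) * unit_time W"
    obtain u1 where u1: "u1 \<le> Y" and [simp]: "\<And>v' t'. call prog 2 (enc_items ts) v' t' \<longleftrightarrow>
        v' = Node (enc_item (a, b, c)) (enc_items r) \<and> t' = u1"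
      using calls_mono[OF calls_bubble[OF le(1)], of Y] le(4) bubble
      by (auto elim!: callsE simp: Y_def)
    have remv: "calls prog 3 (Node (Num x) (enc_items l)) (enc_items (remv x l)) Y"
      if "items_le W l" "length l \<le> L" "x \<le> W" for x l
      using that by (intro calls_mono[OF calls_remv[of W]]) (auto simp: Y_def)
    obtain u2 where u2: "u2 \<le> Y"
        and [simp]: "\<And>v' t'. call prog 3 (Node (Num b) (enc_items es)) v' t' \<longleftrightarrow>
        v' = enc_items (remv b es) \<and> t' = u2"
      using remv[of es b] le(2,5) abc by (auto elim!: callsE)
    obtain u3 where u3: "u3 \<le> Y"
        and [simp]: "\<And>v' t'. call prog 3 (Node (Num a) (enc_items (remv b es))) v' t' \<longleftrightarrow>
        v' = enc_items es' \<and> t' = u3"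
      using remv[of "remv b es" a] le(2,5) abc items_le_remv[of W es b] length_remv_le[of b es]
      by (auto elim!: callsE simp: es'_def)
    obtain u4 where u4: "u4 \<le> Y"
        and [simp]: "\<And>v' t'. call prog 3 (Node (Num b) (enc_items r)) v' t' \<longleftrightarrow>
        v' = enc_items (remv b r) \<and> t' = u4"
      using remv[of r b] le_r len_r abc by (auto elim!: callsE)
    obtain u5 where u5: "u5 \<le> Y"
        and [simp]: "\<And>v' t'. call prog 3 (Node (Num a) (enc_items (remv b r))) v' t' \<longleftrightarrow>
        v' = enc_items (remv a (remv b r)) \<and> t' = u5"
      using remv[of "remv b r" a] le_r len_r abc items_le_remv[of W r b] length_remv_le[of b r]
      by (auto elim!: callsE)
    have "(length r + 1) * ((length es' + 2) * unit_time W) \<le> (L + 1) * ((L + 2) * unit_time W)"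
      using len_r le_es' by (intro mult_le_mono) auto
    then have "calls prog 5 (Node (enc_items es') (enc_items r)) (enc_items (rekey es' r))
        ((L + 1) * ((L + 2) * unit_time W))"
      by (rule calls_mono[OF calls_rekey[OF le_es'(1,2) le_r]])
    then obtain u6 where u6: "u6 \<le> (L + 1) * ((L + 2) * unit_time W)"
      and [simp]: "\<And>v' t'. call prog 5 (Node (enc_items es') (enc_items r)) v' t' \<longleftrightarrow>
        v' = enc_items (rekey es' r) \<and> t' = u6"
      by (auto elim!: callsE)
    define R1 where "R1 = srec vm N (k - Suc 0) N ts' es' (t - c)"
    define R2 where "R2 = srec vm N k (d - Suc 0) r es t"
    have R: "srec vm N k d ts es t \<longleftrightarrow> R1 \<or> R2"
      using srec_bubble_Cons[OF bubble pos(1,2,3)] by (simp add: R1_def R2_def ts'_def es'_def)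
    \<comment> \<open>A binary tree whose subtrees have at most \<open>Z = 2 ^ h - 1\<close> nodes
      has at most \<open>1 + 2 * Z = 2 ^ (h + 1) - 1\<close> nodes, each charged
      \<open>P\<close>.\<close>
    define Z where "Z = (2::nat) ^ (k * (N + 1) + d) - 1"
    have X: "X = P + 2 * (P * Z)"
      unfolding X_def Z_def by (simp add: diff_mult_distrib2 mult.assoc)
    have "calls prog 7 (sargs f ts' es' (k - 1) N N (t - c)) (Num (if R1 then 1 else 0))
        (P * (2 ^ ((k - 1) * (N + 1) + N + 1) - 1))"
      unfolding R1_def P_def using step.IH(1)[of ts' es' N "t - c"] pos le le_es' le_ts' by simp
    \<comment> \<open>A selection loses \<open>N + 1\<close> from the first summand and regains only
      \<open>N\<close> through the reset budget.\<close>
    moreover have "(k - 1) * (N + 1) + N + 1 \<le> k * (N + 1) + d"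
      using pos(2) by (cases k) auto
    then have "P * (2 ^ ((k - 1) * (N + 1) + N + 1) - 1) \<le> P * Z"
      unfolding Z_def by (intro mult_left_mono diff_le_mono power_increasing) auto
    ultimately have "calls prog 7 (sargs f ts' es' (k - 1) N N (t - c))
        (Num (if R1 then 1 else 0)) (P * Z)"
      by (rule calls_mono)
    then obtain s1 where s1: "s1 \<le> P * Z" and [simp]: "\<And>v' t'. call prog 7
        (Node (Num f) (Node (enc_items ts') (Node (enc_items es') (Node (Num (k - Suc 0))
          (Node (Num N) (Node (Num N) (Node (Num (t - c)) (Num 0))))))))  v' t' \<longleftrightarrow>
        v' = Num (if R1 then 1 else 0) \<and> t' = s1"
      by (auto elim!: callsE simp: sargs_def)
    have "calls prog 7 (sargs f r es k (d - 1) N t) (Num (if R2 then 1 else 0)) (P * Z)"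
      unfolding R2_def P_def Z_def using step.IH(2)[of r es t] pos le le_r len_r by simp
    then obtain s2 where s2: "s2 \<le> P * Z" and [simp]: "\<And>v' t'. call prog 7
        (Node (Num f) (Node (enc_items r) (Node (enc_items es) (Node (Num k)
          (Node (Num (d - Suc 0)) (Node (Num N) (Node (Num t) (Num 0))))))))  v' t' \<longleftrightarrow>
        v' = Num (if R2 then 1 else 0) \<and> t' = s2"
      by (auto elim!: callsE simp: sargs_def)
    \<comment> \<open>Three units pay for the body, the five \<open>Y\<close> for
      \<open>bubble\<close> and four removals, the last term for \<open>rekey\<close>. Both ways of
      forming \<open>ts'\<close> are charged, though a run takes only one.\<close>
    have "3 * unit_time W + 5 * Y + (L + 1) * ((L + 2) * unit_time W) \<le> P"
      unfolding P_def step_time_def Y_def by (simp add: power2_eq_square algebra_simps)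
    then have cost: "300 + 60 * floorlog 2 W + u1 + u2 + u3 + u4 + u5 + u6 + s1 + s2 \<le> X"
      unfolding X using u1 u2 u3 u4 u5 u6 s1 s2 by (simp add: unit_time_def)
    have fl: "floorlog 2 k \<le> floorlog 2 W" "floorlog 2 d \<le> floorlog 2 W"
      "floorlog 2 t \<le> floorlog 2 W" "floorlog 2 c \<le> floorlog 2 W"
      "floorlog 2 (Suc 0) \<le> floorlog 2 W"
      using le abc pos by (auto intro!: floorlog_le)
    have ts'_if: "vm \<Longrightarrow> ts' = rekey es' r" "\<not> vm \<Longrightarrow> ts' = remv a (remv b r)"
      by (auto simp: ts'_def)
    show ?thesis
      unfolding calls_def call srec_body_def R using pos cost fl
      by (cases vm; cases R1)
        (simp_all add: sargs_def eval_iffs arg_numeral remv2_def key_def val_list_eq_0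
          f ts'_if[symmetric])
  qed
  then show ?case unfolding X_def P_def .
qed

text \<open>One third of the bound pays for the preparation (computing \<open>N\<close> and the
  initial keys), and one third for each search.\<close>

lemma calls_main:
  assumes le: "items_le W es" "sumw es \<le> W" "\<forall>v\<in>set vs. v \<le> W" "length vs \<le> L" "length es \<le> L"
    "k \<le> W" "t \<le> W" "s \<le> W" and N: "N = 2 ^ (2 * k + 2)" "N \<le> W"
  shows "calls prog 0
    (val_list [val_list (map Num vs), enc_items es, Num k, Num t, Num s])
    (Num (if srec True N k N (rekey es (vertex_items vs)) es t
        \<and> srec False N k N es [] s then 1 else 0))
    (3 * (step_time L W * 2 ^ (k * (N + 1) + N + 1)))"
proof -
  define P where "P = step_time L W"
  define Z where "Z = (2::nat) ^ (k * (N + 1) + N + 1)"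
  define TS where "TS = rekey es (vertex_items vs)"
  define R1 where "R1 = srec True N k N TS es t"
  define R2 where "R2 = srec False N k N es [] s"
  have "2 * k + 2 < N" unfolding N by (rule less_exp)
  define Y where "Y = (2 * k + 2 + 1) * unit_time W"
  have eq: "2 * k + 2 = Suc (Suc (k + k))" by simp
  have "calls prog 1 (Num (2 * k + 2)) (Num N) Y"
    unfolding N(1) Y_def by (rule calls_pow2) (use N in \<open>simp_all add: prog_def\<close>)
  then obtain u1 where u1: "u1 \<le> Y"
    and [simp]: "\<And>v' t'. call prog (Suc 0) (Num (Suc (Suc (k + k)))) v' t' \<longleftrightarrow> v' = Num N \<and> t' = u1"
    unfolding eq by (auto elim!: callsE)
  obtain u2 where u2: "u2 \<le> (length vs + 1) * unit_time W"
    and [simp]: "\<And>v' t'. call prog 6 (val_list (map Num vs)) v' t' \<longleftrightarrow>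
        v' = enc_items (vertex_items vs) \<and> t' = u2"
    using calls_vertex_items[of vs W] by (auto elim!: callsE)
  have u2': "u2 \<le> (L + 1) * unit_time W"
    using u2 le(4) by (elim order_trans) (intro mult_right_mono, auto)
  have le_vertex_items: "items_le W (vertex_items vs)" using le(3) by (auto simp: items_le_iff)
  have "(length (vertex_items vs) + 1) * ((length es + 2) * unit_time W)
      \<le> (L + 1) * ((L + 2) * unit_time W)"
    using le by (intro mult_le_mono) auto
  then have "calls prog 5 (Node (enc_items es) (enc_items (vertex_items vs))) (enc_items TS)
      ((L + 1) * ((L + 2) * unit_time W))"
    unfolding TS_def by (rule calls_mono[OF calls_rekey[OF le(1,2) le_vertex_items]])
  then obtain u3 where u3: "u3 \<le> (L + 1) * ((L + 2) * unit_time W)"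
    and [simp]: "\<And>v' t'. call prog 5 (Node (enc_items es) (enc_items (vertex_items vs))) v' t' \<longleftrightarrow>
      v' = enc_items TS \<and> t' = u3"
    by (auto elim!: callsE)
  have "calls prog 7 (sargs 1 TS es k N N t) (Num (if R1 then 1 else 0)) (P * (Z - 1))"
    unfolding P_def Z_def R1_def
    using le N items_le_rekey[OF le_vertex_items le(2)] by (intro calls_srec) (auto simp: TS_def)
  then obtain s1 where s1: "s1 \<le> P * (Z - 1)"
    and [simp]: "\<And>v' t'. call prog 7
      (Node (Num (Suc 0)) (Node (enc_items TS) (Node (enc_items es) (Node (Num k)
          (Node (Num N) (Node (Num N) (Node (Num t) (Num 0))))))))  v' t' \<longleftrightarrow>
        v' = Num (if R1 then 1 else 0) \<and> t' = s1"
    by (auto elim!: callsE simp: sargs_def)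
  have "calls prog 7 (sargs 0 es [] k N N s) (Num (if R2 then 1 else 0)) (P * (Z - 1))"
    unfolding P_def Z_def R2_def using le N by (intro calls_srec) auto
  then obtain s2 where s2: "s2 \<le> P * (Z - 1)"
    and [simp]: "\<And>v' t'. call prog 7
      (Node (Num 0) (Node (enc_items es) (Node (Num 0) (Node (Num k)
          (Node (Num N) (Node (Num N) (Node (Num s) (Num 0))))))))  v' t' \<longleftrightarrow>
        v' = Num (if R2 then 1 else 0) \<and> t' = s2"
    by (auto elim!: callsE simp: sargs_def)
  have "2 * k + 4 \<le> Z"
  proof -
    have "2 * k + 4 \<le> 2 ^ (N + 1)"
      using \<open>2 * k + 2 < N\<close> less_exp[of "N + 1"] by linarith
    also have "\<dots> \<le> Z" unfolding Z_def by (intro power_increasing) auto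
    finally show ?thesis .
  qed
  have "unit_time W \<le> P" unfolding P_def step_time_def by simp
  have P1: "2 * unit_time W + (L + 1) * unit_time W + (L + 1) * ((L + 2) * unit_time W) \<le> P"
    unfolding P_def step_time_def by (simp add: power2_eq_square algebra_simps)
  define X where "X = 3 * (P * Z)"
  have "(2 * k + 3) * unit_time W \<le> (2 * k + 3) * P" using \<open>unit_time W \<le> P\<close>
      by (intro mult_left_mono) auto
  then have "2 * unit_time W + u1 + u2 + u3 \<le> (2 * k + 4) * P"
    using P1 u1 u2' u3 unfolding Y_def by (simp add: algebra_simps)
  also have "\<dots> \<le> P * Z" using \<open>2 * k + 4 \<le> Z\<close> by simp
  finally have "2 * unit_time W + u1 + u2 + u3 \<le> P * Z" .
  moreover have "s1 \<le> P * Z" "s2 \<le> P * Z"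
    using s1 s2 by (auto elim!: order_trans)
  ultimately have cost: "200 + 40 * floorlog 2 W + u1 + u2 + u3 + s1 + s2 \<le> X"
    unfolding X_def by (simp add: unit_time_def)
  have fl: "floorlog 2 k \<le> floorlog 2 W" "floorlog 2 (k + k) \<le> floorlog 2 W"
    "floorlog 2 2 \<le> floorlog 2 W"
    using le N \<open>2 * k + 2 < N\<close> by (auto intro!: floorlog_le)
  have "calls prog 0
    (val_list [val_list (map Num vs), enc_items es, Num k, Num t, Num s])
    (Num (if R1 \<and> R2 then 1 else 0)) X"
    unfolding calls_def call_prog main_body_def using cost fl
    by (cases R1; cases R2) (simp_all add: eval_iffs arg_numeral del: map_map)
  then show ?thesis unfolding X_def P_def Z_def R1_def R2_def TS_def .
qed

section \<open>The running time\<close>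

lemma computable_double_exp: "computable (\<lambda>n. 2 ^ (2 ^ (3 * n + 5)))"
proof -
  define p where
    "p = [ECall 1 (ECall 1 (EAdd (EAdd (EAdd (EVar 0) (EVar 0)) (EVar 0)) (EConst 5))), pow2_body]"
  have pow: "\<exists>t. \<forall>v' t'. call p (Suc 0) (Num m) v' t' \<longleftrightarrow> v' = Num (2 ^ m) \<and> t' = t" for m
    using calls_pow2[of p m "2 ^ m"] by (auto elim!: callsE simp: p_def)
  have "\<exists>t. run p (Num n) (Num (2 ^ (2 ^ (3 * n + 5)))) t" for n
  proof -
    have eq: "n + n + n + 5 = 3 * n + 5" by simp
    obtain s where s: "\<And>v' t'. call p (Suc 0) (Num (3 * n + 5)) v' t' \<longleftrightarrow>
        v' = Num (2 ^ (3 * n + 5)) \<and> t' = s"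
      using pow by blast
    obtain s' where s': "\<And>v' t'. call p (Suc 0) (Num (2 ^ (3 * n + 5))) v' t' \<longleftrightarrow>
        v' = Num (2 ^ (2 ^ (3 * n + 5))) \<and> t' = s'"
      using pow by blast
    have p: "p ! 0 = ECall 1 (ECall 1 (EAdd (EAdd (EAdd (EVar 0) (EVar 0)) (EVar 0)) (EConst 5)))"
      "p \<noteq> []" by (simp_all add: p_def)
    show ?thesis
      unfolding run_def p using p(2)
      by (simp add: eval_iffs eq s s' del: power_Suc)
  qed
  then show ?thesis unfolding computable_def by blast
qed

lemma less_exp_val_size: "n < 2 ^ val_size (Num n)"
proof -
  have "n < 2 ^ floorlog 2 n" using floorlog_bounds[of n 2] by (cases "n = 0") auto
  also have "\<dots> \<le> 2 ^ val_size (Num n)" by (intro power_increasing) auto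
  finally show ?thesis .
qed

lemma val_size_le_val_list: "x \<in> set xs \<Longrightarrow> val_size x \<le> val_size (val_list xs)"
  by (induction xs) auto

lemma length_le_val_list: "length xs \<le> val_size (val_list xs)"
  by (induction xs) auto

lemma le_exp_val_size: "val_size (Num n) \<le> S \<Longrightarrow> n \<le> 2 ^ S"
  using less_exp_val_size[of n] power_increasing[of "val_size (Num n)" S "2::nat"] by simp

text \<open>Each item lengthens the encoding by more than the size of its weight, and the surplus
  absorbs the doubling when two powers of 2 are added.\<close>

lemma sumw_less: "sumw es < 2 ^ val_size (enc_items es)"
proof (induction es rule: sumw.induct)
  case (2 a b c es)
  let ?p = "val_size (Num c)" and ?q = "val_size (enc_items es)"
  have "c + sumw es < 2 ^ ?p + 2 ^ ?q" using 2 less_exp_val_size[of c] by simp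
  also have "\<dots> \<le> 2 ^ (?p + ?q) + 2 ^ (?p + ?q)"
    by (intro add_mono power_increasing) auto
  also have "\<dots> = 2 ^ (?p + ?q + 1)" by simp
  also have "\<dots> \<le> 2 ^ val_size (enc_items ((a, b, c) # es))"
    by (intro power_increasing) auto
  finally show ?case by simp
qed simp

text \<open>This separates \<open>S\<close> from \<open>k\<close>. As \<open>floorlog 2 W\<close> is
  linear in \<open>S + k\<close>, one factor \<open>S + 1\<close> comes from bit lengths and two
  come from list lengths; all else depends on \<open>k\<close> and fits under the double
  exponential.\<close>

lemma time_bound:
  assumes "W = 2 ^ S + N" "N = 2 ^ (2 * k + 2)"
  shows "3 * (step_time S W * 2 ^ (k * (N + 1) + N + 1)) \<le> 2 ^ (2 ^ (3 * k + 5)) * (S + 1) ^ 3"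
proof -
  let ?E = "k * (N + 1) + N + 1"
  have "W < 2 ^ (S + 2 * k + 4)"
  proof -
    have "W \<le> 2 ^ (S + 2 * k + 2) + 2 ^ (S + 2 * k + 2)"
      unfolding assms by (intro add_mono power_increasing) auto
    also have "\<dots> = 2 ^ (S + 2 * k + 3)" by (simp add: power_add)
    also have "\<dots> < 2 ^ (S + 2 * k + 4)" by (intro power_strict_increasing) auto
    finally show ?thesis .
  qed
  then have "floorlog 2 W \<le> S + 2 * k + 4" by (simp add: floorlog_le_iff)
  then have "unit_time W \<le> 180 * ((S + 1) * (k + 1))" by (simp add: unit_time_def algebra_simps)
  moreover have "(S + 2)\<^sup>2 \<le> 4 * (S + 1)\<^sup>2" by (simp add: power2_eq_square algebra_simps)
  ultimately have "step_time S W \<le> 10 * (4 * (S + 1)\<^sup>2) * (180 * ((S + 1) * (k + 1)))"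
    unfolding step_time_def by (intro mult_le_mono) auto
  also have "\<dots> = 7200 * (k + 1) * (S + 1) ^ 3"
      by (simp add: power2_eq_square power3_eq_cube algebra_simps)
  finally have "3 * (step_time S W * 2 ^ ?E) \<le> 3 * (7200 * (k + 1) * (S + 1) ^ 3 * 2 ^ ?E)"
    by (intro mult_le_mono) auto
  also have "\<dots> = (21600 * (k + 1) * 2 ^ ?E) * (S + 1) ^ 3" by simp
  also have "\<dots> \<le> 2 ^ (2 ^ (3 * k + 5)) * (S + 1) ^ 3"
  proof (rule mult_right_mono)
    have k: "k + 1 \<le> 2 ^ k" by (simp add: Suc_le_eq)
    \<comment> \<open>\<open>2 ^ 15 = 32768\<close> exceeds 21600.\<close>
    have "21600 * (k + 1) * 2 ^ ?E \<le> 2 ^ 15 * 2 ^ k * 2 ^ ?E"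
      using k by (intro mult_le_mono) auto
    also have "\<dots> = 2 ^ (15 + k + ?E)" by (simp only: power_add)
    also have "\<dots> \<le> 2 ^ (2 ^ (3 * k + 5))"
    proof (rule power_increasing)
      have "(k + 1) * (N + 1) \<le> 2 ^ k * 2 ^ (2 * k + 3)"
        using k unfolding assms by (intro mult_le_mono) (simp_all add: power_add)
      also have "\<dots> = 2 ^ (3 * k + 3)" by (simp flip: power_add)
      finally have 1: "(k + 1) * (N + 1) \<le> 2 ^ (3 * k + 3)" .
      have "15 + k \<le> 16 * 2 ^ k" using k by linarith
      also have "\<dots> = 2 ^ (k + 4)" by (simp add: power_add)
      also have "\<dots> \<le> 2 ^ (3 * k + 4)" by (intro power_increasing) auto
      finally have 2: "15 + k \<le> 2 ^ (3 * k + 4)" .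
      have "15 + k + ?E = 15 + k + (k + 1) * (N + 1)" by simp
      also have "\<dots> \<le> 2 ^ (3 * k + 4) + 2 ^ (3 * k + 3)" using 1 2 by linarith
      also have "\<dots> \<le> 2 ^ (3 * k + 5)" by (simp add: power_add)
      finally show "15 + k + ?E \<le> 2 ^ (3 * k + 5)" .
    qed simp
    finally show "21600 * (k + 1) * 2 ^ ?E \<le> 2 ^ (2 ^ (3 * k + 5))" .
  qed simp
  finally show ?thesis .
qed

theorem theorem4:
  "fpt_solvable {I. mepvcb_instance I \<and> k3 I \<le> k1 I} mepvcb_encodes mepvcb_yes k1"
  unfolding fpt_solvable_def
proof (rule exI[of _ prog], rule exI[of _ "\<lambda>n. 2 ^ (2 ^ (3 * n + 5))"],
    rule exI[of _ "[:1, 1:] ^ 3"], intro conjI ballI allI impI)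
  show "computable (\<lambda>n. 2 ^ (2 ^ (3 * n + 5)))" by (rule computable_double_exp)
next
  fix I x assume "I \<in> {I. mepvcb_instance I \<and> k3 I \<le> k1 I}" and enc: "mepvcb_encodes I x"
  then have I: "mepvcb_instance I" and le: "k3 I \<le> k1 I" by auto
  have lam: "(\<lambda>(u, v, c). {u, v}) = ends" "(\<lambda>(u, v, c). val_list [Num u, Num v, Num c]) = enc_item"
    by (auto simp: fun_eq_iff ends_def)
  obtain vs es where vs: "distinct vs" "set vs = verts I"
    and es: "distinct (map ends es)" "set (map ends es) = edges I"
      "\<forall>(u, v, c)\<in>set es. c = weight I {u, v}"
    and x: "x = val_list [val_list (map Num vs), enc_items es, Num (k1 I), Num (k2 I), Num (k3 I)]"
    using enc unfolding mepvcb_encodes_def lam by blast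
  have wt: "\<forall>e\<in>set es. wt e = weight I (ends e)"
    using es(3) by (auto simp: wt_def ends_def)
  define S where "S = val_size x"
  define N where "N = (2::nat) ^ (2 * k1 I + 2)"
  \<comment> \<open>\<open>W\<close> dominates all operands: the input numbers and the total weight
    are at most \<open>2 ^ S\<close>, and the discard counter never exceeds
    \<open>N\<close>.\<close>
  define W where "W = 2 ^ S + N"
  have sub: "val_size y \<le> S"
    if "y \<in> {val_list (map Num vs), enc_items es, Num (k1 I), Num (k2 I), Num (k3 I)}" for y
    unfolding S_def x using that by (intro val_size_le_val_list) auto
  have num: "n \<le> W" if "val_size (Num n) \<le> S" for n
    using le_exp_val_size[OF that] by (simp add: W_def)
  have "items_le W es"
    unfolding items_le_iff
  proof clarify
    fix a b c assume "(a, b, c) \<in> set es"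
    then have "val_size (enc_item (a, b, c)) \<le> val_size (enc_items es)"
      by (intro val_size_le_val_list) force
    then have "val_size (enc_item (a, b, c)) \<le> S" using sub[of "enc_items es"] by simp
    then show "a \<le> W \<and> b \<le> W \<and> c \<le> W" by (intro conjI num) auto
  qed
  moreover have "sumw es \<le> W"
  proof -
    have "sumw es \<le> 2 ^ val_size (enc_items es)" using sumw_less[of es] by simp
    also have "\<dots> \<le> 2 ^ S" using sub by (intro power_increasing) auto
    finally show ?thesis by (simp add: W_def)
  qed
  moreover have "\<forall>v\<in>set vs. v \<le> W"
  proof
    fix v assume "v \<in> set vs"
    then have "val_size (Num v) \<le> val_size (val_list (map Num vs))"
      by (intro val_size_le_val_list) simp
    then have "val_size (Num v) \<le> S" using sub[of "val_list (map Num vs)"] by simp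
    then show "v \<le> W" by (rule num)
  qed
  moreover have "length vs \<le> S"
    using length_le_val_list[of "map Num vs"] sub[of "val_list (map Num vs)"] by simp
  moreover have "length es \<le> S"
    using length_le_val_list[of "map enc_item es"] sub[of "enc_items es"] by simp
  moreover have "k1 I \<le> W" "k2 I \<le> W" "k3 I \<le> W" using sub by (auto intro!: num)
  moreover have "N \<le> W" by (simp add: W_def)
  ultimately have "calls prog 0 x
    (Num (if srec True N (k1 I) N (rekey es (vertex_items vs)) es (k2 I)
        \<and> srec False N (k1 I) N es [] (k3 I) then 1 else 0))
    (3 * (step_time S W * 2 ^ (k1 I * (N + 1) + N + 1)))"
    unfolding x by (intro calls_main) (auto simp: N_def)
  then have "calls prog 0 x (Num (if mepvcb_yes I then 1 else 0))
      (3 * (step_time S W * 2 ^ (k1 I * (N + 1) + N + 1)))"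
    using main_correct[OF I le vs es(1) _ wt N_def] es(2) by simp
  then have "calls prog 0 x (Num (if mepvcb_yes I then 1 else 0))
      (2 ^ (2 ^ (3 * k1 I + 5)) * (S + 1) ^ 3)"
    using time_bound[OF W_def N_def] by (rule calls_mono)
  moreover have "poly ([:1, 1:] ^ 3) (val_size x) = (S + 1) ^ 3"
    by (simp add: S_def)
  ultimately show "\<exists>t. run prog x (Num (if mepvcb_yes I then 1 else 0)) t \<and>
      t \<le> 2 ^ (2 ^ (3 * k1 I + 5)) * poly ([:1, 1:] ^ 3) (val_size x)"
    unfolding calls_def call_def run_def by (auto simp: prog_def)
qed

end
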